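(* Let $d\ge 1$ and let $Y(\mathbf t)$, $\mathbf t\in\mathbb R^d$, be a centered Gaussian random field with continuous sample paths which is homogeneous (i.e. its covariance $E\,Y(\mathbf t)Y(\mathbf s)=B_Y(\mathbf t-\mathbf s)$ depends only on $\mathbf t-\mathbf s$), with $B_Y(\mathbf t)\ge 0$ for all $\mathbf t\in\mathbb R^d$ and $B_Y(\mathbf 0)=1$. Then for every bounded region $G\subset\mathbb R^d$ with a regular boundary the persistence exponent $$\theta_Y(G)=\lim_{T\to\infty}\frac{-\ln P\big(Y(\mathbf t)\le 0 \text{ for all } \mathbf t\in TG\big)}{T^d}$$ exists and is finite. If, in addition, $B_Y\in L_1(\mathbb R^d)$, then $\theta_Y(G)>0$.
   Context: A region $G\subset\mathbb R^d$ is a connected set having interior points and finite volume $|G|$. For $T>0$, $TG=\{T\mathbf t:\mathbf t\in G\}$; $T\to\infty$ through real values. A bounded region $G$ has a regular boundary if, for the standard partition of $\mathbb R^d$ into cubes of the rectangular lattice with step $\delta$, both the total volume of the lattice cubes contained in $G$ (internal measure) and the total volume of the lattice cubes that intersect $G$ (external measure) equal $|G|(1+o(1))$ as $\delta\downarrow 0$. *)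

theory Defs
  imports "HOL-Probability.Probability" "HOL-Library.Landau_Symbols"
begin

text \<open>Degenerate laws (almost surely constant variables) count as Gaussian.\<close>

definition gaussian_rv :: "'w measure \<Rightarrow> ('w \<Rightarrow> real) \<Rightarrow> bool" where
  "gaussian_rv M X \<longleftrightarrow>
     (\<exists>\<mu> \<sigma>. 0 < \<sigma> \<and> distributed M lborel X (normal_density \<mu> \<sigma>)) \<or>
     (X \<in> borel_measurable M \<and> (\<exists>c. AE \<omega> in M. X \<omega> = c))"

definition gaussian_field :: "'w measure \<Rightarrow> ('t \<Rightarrow> 'w \<Rightarrow> real) \<Rightarrow> bool" where
  "gaussian_field M Y \<longleftrightarrow>
     prob_space M \<and> (\<forall>t. Y t \<in> borel_measurable M) \<and>
     (\<forall>F c. finite F \<longrightarrow> gaussian_rv M (\<lambda>\<omega>. \<Sum>t\<in>F. c t * Y t \<omega>))"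

definition centered_field :: "'w measure \<Rightarrow> ('t \<Rightarrow> 'w \<Rightarrow> real) \<Rightarrow> bool" where
  "centered_field M Y \<longleftrightarrow> (\<forall>t. integral\<^sup>L M (Y t) = 0)"

definition continuous_paths ::
    "'w measure \<Rightarrow> ('t::topological_space \<Rightarrow> 'w \<Rightarrow> real) \<Rightarrow> bool" where
  "continuous_paths M Y \<longleftrightarrow> (\<forall>\<omega>\<in>space M. continuous_on UNIV (\<lambda>t. Y t \<omega>))"

text \<open>Homogeneity of a centered field, with covariance function \<open>B\<close>.\<close>

definition homogeneous_cov ::
    "'w measure \<Rightarrow> ('t::ab_group_add \<Rightarrow> 'w \<Rightarrow> real) \<Rightarrow> ('t \<Rightarrow> real) \<Rightarrow> bool" where
  "homogeneous_cov M Y B \<longleftrightarrow>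
     (\<forall>t s. integral\<^sup>L M (\<lambda>\<omega>. Y t \<omega> * Y s \<omega>) = B (t - s))"

definition region :: "(real ^ 'n) set \<Rightarrow> bool" where
  "region G \<longleftrightarrow> connected G \<and> interior G \<noteq> {} \<and> G \<in> lmeasurable"

text \<open>The half-open cubes form a genuine partition of the space.\<close>

definition lattice_cube :: "real \<Rightarrow> (int ^ 'n) \<Rightarrow> (real ^ 'n) set" where
  "lattice_cube \<delta> k =
     {t. \<forall>i. \<delta> * of_int (k $ i) \<le> t $ i \<and> t $ i < \<delta> * (of_int (k $ i) + 1)}"

text \<open>For bounded \<open>G\<close> and \<open>\<delta> > 0\<close> only finitely many cubes occur in either sum.\<close>

definition internal_volume :: "real \<Rightarrow> (real ^ 'n) set \<Rightarrow> real" where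
  "internal_volume \<delta> G =
     (\<Sum>k\<in>{k. lattice_cube \<delta> k \<subseteq> G}. measure lebesgue (lattice_cube \<delta> k))"

definition external_volume :: "real \<Rightarrow> (real ^ 'n) set \<Rightarrow> real" where
  "external_volume \<delta> G =
     (\<Sum>k\<in>{k. lattice_cube \<delta> k \<inter> G \<noteq> {}}. measure lebesgue (lattice_cube \<delta> k))"

text \<open>\<open>f \<sim> |G|\<close> is \<open>f = |G| (1 + o(1))\<close>; the notion is meant for bounded regions.\<close>

definition regular_boundary :: "(real ^ 'n) set \<Rightarrow> bool" where
  "regular_boundary G \<longleftrightarrow>
     (\<lambda>\<delta>. internal_volume \<delta> G) \<sim>[at_right 0] (\<lambda>_. measure lebesgue G) \<and>
     (\<lambda>\<delta>. external_volume \<delta> G) \<sim>[at_right 0] (\<lambda>_. measure lebesgue G)"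

text \<open>\<open>- ln p\<close> for a probability \<open>p\<close>, with the value \<open>\<infinity>\<close> at \<open>p = 0\<close>: the
  library's real \<open>ln\<close> satisfies \<open>ln 0 = 0\<close>, which would hide a vanishing probability.\<close>

definition neg_ln :: "real \<Rightarrow> ereal" where
  "neg_ln p = (if p \<le> 0 then \<infinity> else ereal (- ln p))"

definition persistence_prob ::
    "'w measure \<Rightarrow> ('t \<Rightarrow> 'w \<Rightarrow> real) \<Rightarrow> 't set \<Rightarrow> real" where
  "persistence_prob M Y A = measure M {\<omega> \<in> space M. \<forall>t\<in>A. Y t \<omega> \<le> 0}"

definition has_persistence_exponent ::
    "'w measure \<Rightarrow> (real ^ 'n \<Rightarrow> 'w \<Rightarrow> real) \<Rightarrow> (real ^ 'n) set \<Rightarrow> ereal \<Rightarrow> bool" where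
  "has_persistence_exponent M Y G \<theta> \<longleftrightarrow>
     ((\<lambda>T. neg_ln (persistence_prob M Y ((*\<^sub>R) T ` G)) / ereal (T ^ CARD('n)))
        \<longlongrightarrow> \<theta>) at_top"

end

theory Submission
  imports Defs "HOL-Computational_Algebra.Polynomial"
begin

text \<open>
  Write \<open>P(A)\<close> for the probability that \<open>Y \<le> 0\<close> on \<open>A\<close>.  Two facts about Gaussian fields with
  nonnegative covariance carry the proof.

  The first is Slepian's inequality (\<open>slepian\<close>): raising the covariances of a Gaussian vector while
  keeping the variances fixed raises the probability that all coordinates are \<open>\<le> 0\<close>.  Comparing \<open>Y\<close>
  on \<open>A \<union> A'\<close> with two independent copies of \<open>Y\<close>, one on each part, gives \<open>P(A) P(A') \<le> P(A \<union> A')\<close>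
  (\<open>pers_union\<close>); comparing \<open>Y\<close> with its translates in both directions gives translation invariance
  (\<open>pers_translate\<close>).  Hence \<open>- ln P\<close> is monotone, subadditive and translation invariant, and
  \<open>P(A) > 0\<close> for bounded \<open>A\<close>, because \<open>Y\<close> is negative on some small ball with positive probability
  and finitely many such balls cover \<open>A\<close>.  The exponent is \<open>\<theta>(G) = |G| \<cdot> r\<close>, where \<open>r\<close> is the infimum over
  \<open>L\<close> of the cost per volume \<open>- ln P(Q) / L\<^sup>d\<close> of a cube \<open>Q\<close> of side \<open>L\<close>.  Covering \<open>T G\<close> by the cubes of
  side \<open>L\<close> that meet it bounds the limit from above.  Subadditivity bounds it from below as well:
  a large cube around \<open>T G\<close> costs at least \<open>r\<close> per unit of volume, and the part of it outside \<open>T G\<close> costs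
  at most what the cubes not contained in \<open>T G\<close> cost together.  Regularity of the boundary makes the two
  cube counts agree to leading order, so the bounds meet when the cost of the cube of side \<open>L\<close> is
  nearly optimal.

  The second fact is a bound in the opposite direction.  For a decreasing function \<open>h\<close> with
  \<open>1 \<ge> h \<ge> 1\<^bsub>(-\<infinity>,0]\<^esub>\<close> and \<open>|h'| \<le> h\<close>, adding a point \<open>t\<close> to a finite set \<open>A\<close> with \<open>\<Sum>\<^bsub>s \<in> A\<^esub> B(t - s) \<le> \<epsilon>\<close>
  multiplies \<open>E \<Prod> h(Y)\<close> by at most \<open>E h(Y\<^sub>0) / (1 - \<epsilon>)\<close> (\<open>soft_prob_insert_le\<close>), and \<open>E h(Y\<^sub>0) < 1\<close>.  If \<open>B\<close>
  is integrable, then averaging over a set of volume \<open>V\<close> shows that such points can be chosen one after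
  another until their number is of order \<open>V\<close>.  So \<open>P\<close> of the set is exponentially small in
  \<open>V\<close> (\<open>pers_exponential_bound\<close>), and \<open>r > 0\<close>.

  Both facts come from Gaussian interpolation (\<open>gaussian_interpolation\<close>): along a path on which the
  covariance matrix moves linearly from \<open>D\<close> to \<open>C\<close> with constant diagonal, the expectation of \<open>\<Prod>\<^sub>i H(X\<^sub>i)\<close> has derivative
  \<open>\<Sum>\<^bsub>i \<noteq> j\<^esub> (C - D)\<^sub>i\<^sub>j / 2 \<cdot> E (H'(X\<^sub>i) H'(X\<^sub>j) \<Prod>\<^bsub>k \<noteq> i, j\<^esub> H(X\<^sub>k))\<close>.  When \<open>H\<close> is a trigonometric polynomial,
  all expectations are finite sums of values of the characteristic function, and the formula is the
  derivative of an exponential.  It passes to the limit for all bounded \<open>C\<^sup>1\<close> functions \<open>H\<close> with bounded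
  derivative.  Densities do not occur, so degenerate covariance matrices are treated like all others.
\<close>

section \<open>Products of trigonometric polynomials of a Gaussian vector\<close>

text \<open>The characteristic function determines the joint law, behaves well under independent sums, and
  makes sense for degenerate covariances \<open>C\<close>.\<close>

definition gaussian_vector ::
    "'w measure \<Rightarrow> 'i set \<Rightarrow> ('i \<Rightarrow> 'w \<Rightarrow> real) \<Rightarrow> ('i \<Rightarrow> 'i \<Rightarrow> real) \<Rightarrow> bool" where
  "gaussian_vector M I X C \<longleftrightarrow>
     prob_space M \<and> (\<forall>i\<in>I. X i \<in> borel_measurable M) \<and>
     (\<forall>\<xi>. (\<integral>\<omega>. cis (\<Sum>i\<in>I. \<xi> i * X i \<omega>) \<partial>M) =
       complex_of_real (exp (- (\<Sum>i\<in>I. \<Sum>j\<in>I. \<xi> i * \<xi> j * C i j) / 2)))"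

lemma prod_cis: "(\<Prod>i\<in>I. cis (f i)) = cis (\<Sum>i\<in>I. f i)"
  by (induction I rule: infinite_finite_induct) (auto simp: cis_mult)

text \<open>Expanding the product gives one exponential of a linear combination of the coordinates for every
  choice \<open>f\<close> of a frequency per coordinate, and the characteristic function evaluates each of them.\<close>

lemma expectation_trig_product:
  fixes a :: "'i \<Rightarrow> nat \<Rightarrow> complex" and \<kappa> :: "nat \<Rightarrow> real"
  assumes I: "finite I" and g: "gaussian_vector M I X C"
  shows "(\<integral>\<omega>. (\<Prod>i\<in>I. \<Sum>k\<le>n. a i k * cis (\<kappa> k * X i \<omega>)) \<partial>M) =
    (\<Sum>f\<in>I \<rightarrow>\<^sub>E {..n}. (\<Prod>i\<in>I. a i (f i)) *
       complex_of_real (exp (- (\<Sum>i\<in>I. \<Sum>j\<in>I. \<kappa> (f i) * \<kappa> (f j) * C i j) / 2)))"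
proof -
  interpret prob_space M using g by (simp add: gaussian_vector_def)
  have [measurable]: "X i \<in> borel_measurable M" if "i \<in> I" for i
    using g that by (simp add: gaussian_vector_def)
  have cisb: "cis \<in> borel_measurable borel"
    by (intro borel_measurable_continuous_onI continuous_intros)
  have "(\<integral>\<omega>. (\<Prod>i\<in>I. \<Sum>k\<le>n. a i k * cis (\<kappa> k * X i \<omega>)) \<partial>M) =
    (\<integral>\<omega>. (\<Sum>f\<in>I \<rightarrow>\<^sub>E {..n}. (\<Prod>i\<in>I. a i (f i)) * cis (\<Sum>i\<in>I. \<kappa> (f i) * X i \<omega>)) \<partial>M)"
    using I by (subst prod_sum_PiE) (simp_all add: prod.distrib prod_cis)
  also have "\<dots> = (\<Sum>f\<in>I \<rightarrow>\<^sub>E {..n}. (\<integral>\<omega>. (\<Prod>i\<in>I. a i (f i)) * cis (\<Sum>i\<in>I. \<kappa> (f i) * X i \<omega>) \<partial>M))"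
  proof (rule Bochner_Integration.integral_sum)
    fix f
    have "(\<lambda>\<omega>. cis (\<Sum>i\<in>I. \<kappa> (f i) * X i \<omega>)) \<in> borel_measurable M"
      by (rule measurable_compose[OF _ cisb]) measurable
    then show "integrable M (\<lambda>\<omega>. (\<Prod>i\<in>I. a i (f i)) * cis (\<Sum>i\<in>I. \<kappa> (f i) * X i \<omega>))"
      by (intro integrable_mult_right integrable_const_bound[where B=1]) auto
  qed
  also have "\<dots> = (\<Sum>f\<in>I \<rightarrow>\<^sub>E {..n}. (\<Prod>i\<in>I. a i (f i)) *
       complex_of_real (exp (- (\<Sum>i\<in>I. \<Sum>j\<in>I. \<kappa> (f i) * \<kappa> (f j) * C i j) / 2)))"
  proof (rule sum.cong[OF refl])
    fix f
    have "(\<integral>\<omega>. cis (\<Sum>i\<in>I. \<kappa> (f i) * X i \<omega>) \<partial>M) =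
       complex_of_real (exp (- (\<Sum>i\<in>I. \<Sum>j\<in>I. \<kappa> (f i) * \<kappa> (f j) * C i j) / 2))"
      using g unfolding gaussian_vector_def by (auto elim: allE[of _ "\<lambda>i. \<kappa> (f i)"])
    then show "(\<integral>\<omega>. (\<Prod>i\<in>I. a i (f i)) * cis (\<Sum>i\<in>I. \<kappa> (f i) * X i \<omega>) \<partial>M) =
      (\<Prod>i\<in>I. a i (f i)) * complex_of_real (exp (- (\<Sum>i\<in>I. \<Sum>j\<in>I. \<kappa> (f i) * \<kappa> (f j) * C i j) / 2))"
      by simp
  qed
  finally show ?thesis .
qed

text \<open>A real trigonometric polynomial together with its derivative; the frequencies \<open>\<kappa> k\<close> are arbitrary
  reals.\<close>

definition trig_pair :: "(real \<Rightarrow> real) \<Rightarrow> (real \<Rightarrow> real) \<Rightarrow> bool" where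
  "trig_pair h h' \<longleftrightarrow> (\<exists>n (b :: nat \<Rightarrow> complex) (\<kappa> :: nat \<Rightarrow> real). \<forall>x.
     complex_of_real (h x) = (\<Sum>k\<le>n. b k * cis (\<kappa> k * x)) \<and>
     complex_of_real (h' x) = (\<Sum>k\<le>n. \<i> * \<kappa> k * b k * cis (\<kappa> k * x)))"

lemma has_vector_derivative_cis:
  "((\<lambda>x. cis (k * x)) has_vector_derivative \<i> * k * cis (k * x)) (at x)"
proof -
  have "((\<lambda>x. exp (\<i> * of_real k * of_real x)) has_vector_derivative exp (\<i> * of_real k * of_real x) * (\<i> * of_real k * 1)) (at x)"
    by (rule has_vector_derivative_eq_rhs, (rule derivative_intros has_vector_derivative_real_field)+) (auto intro!: derivative_eq_intros)
  then show ?thesis by (simp add: cis_conv_exp algebra_simps)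
qed

text \<open>This is the supply of trigonometric polynomials: on bounded sets \<open>R sin (x / R)\<close> tends to \<open>x\<close>, so
  that \<open>P (R sin (x / R))\<close> imitates \<open>P\<close> there, but it stays bounded on the whole line.\<close>

lemma trig_pair_sine_polynomial:
  fixes a :: "nat \<Rightarrow> real" and m :: nat
  assumes R: "R \<noteq> 0"
  defines "P \<equiv> \<lambda>u. \<Sum>i\<le>m. a i * u ^ i"
  assumes P': "\<And>u. (P has_real_derivative P' u) (at u)"
  shows "trig_pair (\<lambda>x. P (R * sin (x / R))) (\<lambda>x. P' (R * sin (x / R)) * cos (x / R))"
proof -
  \<comment> \<open>With \<open>z = cis (x / R)\<close> the sine is \<open>(z - 1/z) / (2 \<i>)\<close>; multiplying by \<open>z ^ m\<close> clears the denominators.\<close>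
  define q :: "complex poly" where
    "q = (\<Sum>i\<le>m. smult (of_real (a i) * (of_real R / (2 * \<i>)) ^ i) (monom 1 (m - i) * [:-1, 0, 1:] ^ i))"
  define n where "n = degree q"
  define \<kappa> where "\<kappa> k = (real k - real m) / R" for k :: nat
  have eq: "complex_of_real (P (R * sin (x / R))) = (\<Sum>k\<le>n. coeff q k * cis (\<kappa> k * x))" for x
  proof -
    define z w where "z = cis (x / R)" and "w = cis (- (x / R))"
    have wz: "w * z = 1" by (simp add: w_def z_def cis_mult)
    have sinz: "complex_of_real (R * sin (x / R)) = of_real R / (2 * \<i>) * (z - w)"
      by (simp add: z_def w_def complex_eq_iff)
    have "poly q z = (\<Sum>i\<le>m. of_real (a i) * (of_real R / (2 * \<i>)) ^ i * (z ^ (m - i) * (z * z - 1) ^ i))"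
      by (simp add: q_def poly_sum poly_monom algebra_simps)
    then have "w ^ m * poly q z = (\<Sum>i\<le>m. of_real (a i) * (of_real R / (2 * \<i>)) ^ i * (w ^ m * z ^ (m - i) * (z * z - 1) ^ i))"
      by (simp add: sum_distrib_left mult_ac)
    also have "\<dots> = (\<Sum>i\<le>m. of_real (a i) * (of_real R / (2 * \<i>)) ^ i * (z - w) ^ i)"
    proof (rule sum.cong[OF refl])
      fix i assume i: "i \<in> {..m}"
      then have "w ^ m = w ^ i * w ^ (m - i)" by (simp flip: power_add)
      then have "w ^ m * z ^ (m - i) * (z * z - 1) ^ i = (w * z) ^ (m - i) * (w * (z * z - 1)) ^ i"
        by (simp add: power_mult_distrib mult_ac)
      also have "w * (z * z - 1) = (w * z) * z - w" by (simp add: algebra_simps)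
      also have "\<dots> = z - w" using wz by simp
      finally show "of_real (a i) * (of_real R / (2 * \<i>)) ^ i * (w ^ m * z ^ (m - i) * (z * z - 1) ^ i) =
         of_real (a i) * (of_real R / (2 * \<i>)) ^ i * (z - w) ^ i" using wz by simp
    qed
    also have "\<dots> = (\<Sum>i\<le>m. of_real (a i) * (complex_of_real (R * sin (x / R))) ^ i)"
      by (simp only: sinz power_mult_distrib mult.assoc)
    also have "\<dots> = complex_of_real (P (R * sin (x / R)))" by (simp add: P_def)
    finally have "complex_of_real (P (R * sin (x / R))) = w ^ m * poly q z" by simp
    also have "poly q z = (\<Sum>k\<le>n. coeff q k * z ^ k)" by (simp add: poly_altdef n_def)
    also have "w ^ m * \<dots> = (\<Sum>k\<le>n. coeff q k * cis (\<kappa> k * x))"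
      unfolding sum_distrib_left
    proof (rule sum.cong[OF refl])
      fix k
      have "w ^ m * z ^ k = cis (\<kappa> k * x)"
        using R by (simp add: w_def z_def Complex.DeMoivre cis_mult \<kappa>_def field_simps)
      then show "w ^ m * (coeff q k * z ^ k) = coeff q k * cis (\<kappa> k * x)"
        by (metis mult.left_commute)
    qed
    finally show ?thesis .
  qed
  \<comment> \<open>Differentiating the same function in two ways identifies the derivative.\<close>
  have "complex_of_real (P' (R * sin (x / R)) * cos (x / R)) = (\<Sum>k\<le>n. \<i> * \<kappa> k * coeff q k * cis (\<kappa> k * x))" for x
  proof (rule vector_derivative_unique_at)
    have "((\<lambda>x. P (R * sin (x / R))) has_real_derivative P' (R * sin (x / R)) * cos (x / R)) (at x)"
      using R by (auto intro!: derivative_eq_intros DERIV_chain'[where g=P, OF _ P'])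
    then show "((\<lambda>x. complex_of_real (P (R * sin (x / R)))) has_vector_derivative
       complex_of_real (P' (R * sin (x / R)) * cos (x / R))) (at x)"
      by (rule has_vector_derivative_of_real)
    have "((\<lambda>x. \<Sum>k\<le>n. coeff q k * cis (\<kappa> k * x)) has_vector_derivative
      (\<Sum>k\<le>n. coeff q k * (\<i> * \<kappa> k * cis (\<kappa> k * x)))) (at x)"
      by (intro has_vector_derivative_sum has_vector_derivative_mult_right has_vector_derivative_cis)
    then show "((\<lambda>x. complex_of_real (P (R * sin (x / R)))) has_vector_derivative
       (\<Sum>k\<le>n. \<i> * \<kappa> k * coeff q k * cis (\<kappa> k * x))) (at x)"
      by (simp add: eq mult_ac)
  qed
  with eq show ?thesis unfolding trig_pair_def by blast
qed

section \<open>Gaussian interpolation\<close>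

text \<open>By \<open>expectation_trig_product\<close> the expectation along the path is a finite sum of exponentials
  whose exponents are affine in \<open>s\<close>.  Differentiating brings down \<open>- \<kappa>\<^sub>i \<kappa>\<^sub>j (C - D)\<^sub>i\<^sub>j / 2\<close>, and
  \<open>- \<kappa>\<^sub>i \<kappa>\<^sub>j = (\<i> \<kappa>\<^sub>i) (\<i> \<kappa>\<^sub>j)\<close> is what differentiating the factors \<open>i\<close> and \<open>j\<close> of the product produces.
  Equal variances remove the diagonal terms, which would involve \<open>h''\<close>.\<close>

lemma trig_interpolation:
  fixes X :: "real \<Rightarrow> 'i \<Rightarrow> 'w \<Rightarrow> real" and C D :: "'i \<Rightarrow> 'i \<Rightarrow> real"
  assumes I: "finite I"
    and X: "\<And>s. 0 \<le> s \<Longrightarrow> s \<le> 1 \<Longrightarrow> gaussian_vector M I (X s) (\<lambda>i j. (1 - s) * D i j + s * C i j)"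
    and diag: "\<And>i. i \<in> I \<Longrightarrow> C i i = D i i"
    and h: "trig_pair h h'"
  shows "((\<lambda>s. \<Sum>i\<in>I. \<Sum>j\<in>I - {i}. (C i j - D i j) / 2 *
      (\<integral>\<omega>. h' (X s i \<omega>) * h' (X s j \<omega>) * (\<Prod>k\<in>I - {i, j}. h (X s k \<omega>)) \<partial>M))
    has_integral (\<integral>\<omega>. (\<Prod>i\<in>I. h (X 1 i \<omega>)) \<partial>M) - (\<integral>\<omega>. (\<Prod>i\<in>I. h (X 0 i \<omega>)) \<partial>M)) {0..1}"
    (is "(?\<psi> has_integral _) _")
proof -
  obtain n and b :: "nat \<Rightarrow> complex" and \<kappa> :: "nat \<Rightarrow> real"
    where h_eq: "\<And>x. complex_of_real (h x) = (\<Sum>k\<le>n. b k * cis (\<kappa> k * x))"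
      and h'_eq: "\<And>x. complex_of_real (h' x) = (\<Sum>k\<le>n. \<i> * \<kappa> k * b k * cis (\<kappa> k * x))"
    using h unfolding trig_pair_def by blast
  define Fs where "Fs = I \<rightarrow>\<^sub>E {..n}"
  define q where "q K f = (\<Sum>i\<in>I. \<Sum>j\<in>I. \<kappa> (f i) * \<kappa> (f j) * K i j)" for K f
  define E where "E f s = exp (- (q D f + s * (q C f - q D f)) / 2)" for f s
  define \<Phi> where "\<Phi> s = (\<Sum>f\<in>Fs. (\<Prod>i\<in>I. b (f i)) * complex_of_real (E f s))" for s
  define \<Phi>' where "\<Phi>' s = (\<Sum>f\<in>Fs. (\<Prod>i\<in>I. b (f i)) * complex_of_real (E f s * (- (q C f - q D f) / 2)))" for s
  have q_path: "(\<Sum>i\<in>I. \<Sum>j\<in>I. \<kappa> (f i) * \<kappa> (f j) * ((1 - s) * D i j + s * C i j)) = q D f + s * (q C f - q D f)" for f s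
  proof -
    have "(\<Sum>i\<in>I. \<Sum>j\<in>I. \<kappa> (f i) * \<kappa> (f j) * ((1 - s) * D i j + s * C i j)) = (1 - s) * q D f + s * q C f"
      unfolding q_def sum_distrib_left sum.distrib[symmetric]
      by (intro sum.cong refl) (simp add: algebra_simps)
    then show ?thesis by (simp add: algebra_simps)
  qed
  have expect: "(\<integral>\<omega>. (\<Prod>m\<in>I. \<Sum>k\<le>n. a m k * cis (\<kappa> k * X s m \<omega>)) \<partial>M) =
      (\<Sum>f\<in>Fs. (\<Prod>i\<in>I. a i (f i)) * complex_of_real (E f s))" if "0 \<le> s" "s \<le> 1" for a s
    using expectation_trig_product[OF I X[OF that], where n=n and a=a and \<kappa>=\<kappa>] by (simp add: q_path E_def Fs_def)
  have \<phi>_eq: "complex_of_real (\<integral>\<omega>. (\<Prod>i\<in>I. h (X s i \<omega>)) \<partial>M) = \<Phi> s" if "0 \<le> s" "s \<le> 1" for s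
    unfolding \<Phi>_def expect[OF that, of "\<lambda>_. b", symmetric]
    by (simp add: h_eq flip: integral_complex_of_real)
  have pair_eq: "complex_of_real (\<integral>\<omega>. h' (X s i \<omega>) * h' (X s j \<omega>) * (\<Prod>k\<in>I - {i, j}. h (X s k \<omega>)) \<partial>M) =
      (\<Sum>f\<in>Fs. (\<Prod>m\<in>I. b (f m)) * complex_of_real (E f s * (- (\<kappa> (f i) * \<kappa> (f j)))))"
    if s: "0 \<le> s" "s \<le> 1" and ij: "i \<in> I" "j \<in> I" "i \<noteq> j" for s i j
  proof -
    \<comment> \<open>The coefficients of \<open>h'\<close> in the places \<open>i\<close> and \<open>j\<close>, those of \<open>h\<close> elsewhere.\<close>
    define a where "a m k = (if m = i \<or> m = j then \<i> * \<kappa> k * b k else b k)" for m and k :: nat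
    have I_eq: "I = insert i (insert j (I - {i, j}))" using ij by auto
    have "complex_of_real (h' (X s i \<omega>) * h' (X s j \<omega>) * (\<Prod>k\<in>I - {i, j}. h (X s k \<omega>))) =
        (\<Prod>m\<in>I. \<Sum>k\<le>n. a m k * cis (\<kappa> k * X s m \<omega>))" for \<omega>
    proof -
      have "(\<Prod>m\<in>I. \<Sum>k\<le>n. a m k * cis (\<kappa> k * X s m \<omega>)) =
        (\<Sum>k\<le>n. a i k * cis (\<kappa> k * X s i \<omega>)) * ((\<Sum>k\<le>n. a j k * cis (\<kappa> k * X s j \<omega>)) *
        (\<Prod>m\<in>I - {i, j}. \<Sum>k\<le>n. a m k * cis (\<kappa> k * X s m \<omega>)))"
        using I ij by (subst I_eq) (simp add: prod.insert)
      also have "(\<Sum>k\<le>n. a i k * cis (\<kappa> k * X s i \<omega>)) = h' (X s i \<omega>)" by (simp add: a_def h'_eq)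
      also have "(\<Sum>k\<le>n. a j k * cis (\<kappa> k * X s j \<omega>)) = h' (X s j \<omega>)" by (simp add: a_def h'_eq)
      also have "(\<Prod>m\<in>I - {i, j}. \<Sum>k\<le>n. a m k * cis (\<kappa> k * X s m \<omega>)) = (\<Prod>m\<in>I - {i, j}. complex_of_real (h (X s m \<omega>)))"
        by (intro prod.cong refl) (auto simp: a_def h_eq)
      finally show ?thesis by (simp add: mult.assoc)
    qed
    then have "complex_of_real (\<integral>\<omega>. h' (X s i \<omega>) * h' (X s j \<omega>) * (\<Prod>k\<in>I - {i, j}. h (X s k \<omega>)) \<partial>M) =
        (\<Sum>f\<in>Fs. (\<Prod>i\<in>I. a i (f i)) * complex_of_real (E f s))"
      by (simp only: integral_complex_of_real[symmetric] expect[OF s])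
    also have "\<dots> = (\<Sum>f\<in>Fs. (\<Prod>m\<in>I. b (f m)) * complex_of_real (E f s * (- (\<kappa> (f i) * \<kappa> (f j)))))"
    proof (rule sum.cong[OF refl])
      fix f
      have "(\<Prod>m\<in>I. a m (f m)) = (\<Prod>m\<in>I. (if m = i then \<i> * \<kappa> (f i) else 1) * (if m = j then \<i> * \<kappa> (f j) else 1) * b (f m))"
        using ij by (intro prod.cong refl) (auto simp: a_def)
      also have "\<dots> = (\<i> * \<kappa> (f i)) * (\<i> * \<kappa> (f j)) * (\<Prod>m\<in>I. b (f m))"
        using I ij by (simp add: prod.distrib)
      also have "(\<i> * \<kappa> (f i)) * (\<i> * \<kappa> (f j)) = - complex_of_real (\<kappa> (f i) * \<kappa> (f j))"
        by (simp add: complex_eq_iff)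
      finally show "(\<Prod>m\<in>I. a m (f m)) * complex_of_real (E f s) =
        (\<Prod>m\<in>I. b (f m)) * complex_of_real (E f s * (- (\<kappa> (f i) * \<kappa> (f j))))"
        by simp
    qed
    finally show ?thesis .
  qed
  have \<psi>_eq: "complex_of_real (?\<psi> s) = \<Phi>' s" if s: "0 \<le> s" "s \<le> 1" for s
  proof -
    have "complex_of_real (?\<psi> s) = (\<Sum>i\<in>I. \<Sum>j\<in>I - {i}. complex_of_real ((C i j - D i j) / 2) *
      (\<Sum>f\<in>Fs. (\<Prod>m\<in>I. b (f m)) * complex_of_real (E f s * (- (\<kappa> (f i) * \<kappa> (f j))))))"
      unfolding of_real_sum of_real_mult[of "_ / 2"]
      by (intro sum.cong refl arg_cong2[where f="(*)"] pair_eq s) auto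
    also have "\<dots> = (\<Sum>i\<in>I. \<Sum>j\<in>I. complex_of_real ((C i j - D i j) / 2) *
      (\<Sum>f\<in>Fs. (\<Prod>m\<in>I. b (f m)) * complex_of_real (E f s * (- (\<kappa> (f i) * \<kappa> (f j))))))"
      using I diag by (intro sum.cong refl sum.mono_neutral_left) auto
    also have "\<dots> = (\<Sum>i\<in>I. \<Sum>j\<in>I. \<Sum>f\<in>Fs. (\<Prod>m\<in>I. b (f m)) * complex_of_real (E f s * (- (\<kappa> (f i) * \<kappa> (f j) * (C i j - D i j)) / 2)))"
      unfolding sum_distrib_left by (intro sum.cong refl) (simp add: field_simps)
    also have "\<dots> = (\<Sum>i\<in>I. \<Sum>f\<in>Fs. \<Sum>j\<in>I. (\<Prod>m\<in>I. b (f m)) * complex_of_real (E f s * (- (\<kappa> (f i) * \<kappa> (f j) * (C i j - D i j)) / 2)))"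
      by (rule sum.cong[OF refl], rule sum.swap)
    also have "\<dots> = (\<Sum>f\<in>Fs. \<Sum>i\<in>I. \<Sum>j\<in>I. (\<Prod>m\<in>I. b (f m)) * complex_of_real (E f s * (- (\<kappa> (f i) * \<kappa> (f j) * (C i j - D i j)) / 2)))"
      by (rule sum.swap)
    also have "\<dots> = \<Phi>' s"
      unfolding \<Phi>'_def
    proof (rule sum.cong[OF refl])
      fix f
      have "- (q C f - q D f) / 2 = (\<Sum>i\<in>I. \<Sum>j\<in>I. - (\<kappa> (f i) * \<kappa> (f j) * (C i j - D i j)) / 2)"
        by (simp add: q_def sum_subtractf sum_negf sum_divide_distrib right_diff_distrib diff_divide_distrib)
      then show "(\<Sum>i\<in>I. \<Sum>j\<in>I. (\<Prod>m\<in>I. b (f m)) * complex_of_real (E f s * (- (\<kappa> (f i) * \<kappa> (f j) * (C i j - D i j)) / 2))) =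
        (\<Prod>m\<in>I. b (f m)) * complex_of_real (E f s * (- (q C f - q D f) / 2))"
        by (simp only: sum_distrib_left of_real_sum)
    qed
    finally show ?thesis .
  qed
  have "((\<lambda>s. Re (\<Phi>' s)) has_integral Re (\<Phi> 1) - Re (\<Phi> 0)) {0..1}"
  proof (rule fundamental_theorem_of_calculus)
    fix s :: real
    have "(E f has_real_derivative E f s * (- (q C f - q D f) / 2)) (at s)" for f
      unfolding E_def by (auto intro!: derivative_eq_intros)
    then have "((\<lambda>s. complex_of_real (E f s)) has_vector_derivative
        complex_of_real (E f s * (- (q C f - q D f) / 2))) (at s)" for f
      by (rule has_vector_derivative_of_real)
    then have "(\<Phi> has_vector_derivative \<Phi>' s) (at s)"
      unfolding \<Phi>_def \<Phi>'_def
      by (intro has_vector_derivative_sum has_vector_derivative_mult_right)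
    then show "((\<lambda>s. Re (\<Phi> s)) has_vector_derivative Re (\<Phi>' s)) (at s within {0..1})"
      by (rule has_vector_derivative_at_within[OF bounded_linear.has_vector_derivative[OF bounded_linear_Re]])
  qed simp
  moreover have "Re (\<Phi>' s) = ?\<psi> s" if "s \<in> {0..1}" for s
    using arg_cong[OF \<psi>_eq[of s], of Re] that by simp
  ultimately have "(?\<psi> has_integral Re (\<Phi> 1) - Re (\<Phi> 0)) {0..1}"
    by (rule has_integral_eq[rotated])
  then show ?thesis
    using arg_cong[OF \<phi>_eq[of 0], of Re] arg_cong[OF \<phi>_eq[of 1], of Re] by simp
qed

text \<open>Approximate \<open>H'\<close> by a polynomial on \<open>[-R, R]\<close>, integrate it, and substitute \<open>R sin (x / R)\<close>, whose
  values never leave that interval; the resulting bounds are therefore valid on the whole line.  Uniform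
  convergence on the line cannot be expected of almost periodic functions.\<close>

lemma C1_trig_approximation:
  fixes H H' :: "real \<Rightarrow> real"
  assumes deriv: "\<And>x. (H has_real_derivative H' x) (at x)"
    and cont: "continuous_on UNIV H'"
    and bound: "\<And>x. \<bar>H x\<bar> \<le> K" "\<And>x. \<bar>H' x\<bar> \<le> K"
  obtains h h' where "\<And>n. trig_pair (h n) (h' n)"
    "\<And>n x. \<bar>h n x\<bar> \<le> K + 1" "\<And>n x. \<bar>h' n x\<bar> \<le> K + 1"
    "\<And>x. (\<lambda>n. h n x) \<longlonglongrightarrow> H x" "\<And>x. (\<lambda>n. h' n x) \<longlonglongrightarrow> H' x"
proof -
  define R where "R n = real (Suc n)" for n
  have R: "R n \<ge> 1" for n by (simp add: R_def)
  have "\<exists>h h'. trig_pair h h' \<and> (\<forall>x. \<bar>h x - H (R n * sin (x / R n))\<bar> \<le> 1 / R n) \<and>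
     (\<forall>x. \<bar>h' x - H' (R n * sin (x / R n)) * cos (x / R n)\<bar> \<le> 1 / R n)" for n
  proof -
    have "continuous_on {- R n..R n} H'" using cont continuous_on_subset by blast
    \<comment> \<open>The error \<open>1 / R\<^sup>2\<close> becomes at most \<open>1 / R\<close> after integration over an interval of length at most \<open>R\<close>.\<close>
    then obtain p where p: "real_polynomial_function p" "\<And>u. u \<in> {- R n..R n} \<Longrightarrow> \<bar>H' u - p u\<bar> < 1 / (R n)\<^sup>2"
      using Stone_Weierstrass_real_polynomial_function[of "{- R n..R n}" H' "1 / (R n)\<^sup>2"] R[of n] by (auto simp: power2_eq_square)
    obtain a m where a: "p = (\<lambda>u. \<Sum>i\<le>m. a i * u ^ i)"
      using p(1) by (auto simp: real_polynomial_function_iff_sum)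
    define c where "c i = (case i of 0 \<Rightarrow> H 0 | Suc i \<Rightarrow> a i / real (Suc i))" for i
    define P where "P u = (\<Sum>i\<le>Suc m. c i * u ^ i)" for u
    have P_eq: "P u = H 0 + (\<Sum>i\<le>m. a i / real (Suc i) * u ^ Suc i)" for u
      unfolding P_def by (subst sum.atMost_Suc_shift) (simp add: c_def)
    have P_deriv: "(P has_real_derivative p u) (at u)" for u
    proof -
      have "(P has_real_derivative (\<Sum>i\<le>m. a i / real (Suc i) * (real (Suc i) * u ^ i))) (at u)"
        unfolding P_eq[abs_def]
        by (rule DERIV_cong[OF DERIV_add[OF DERIV_const DERIV_sum[OF DERIV_cmult[OF DERIV_pow]]]]) simp
      moreover have "(\<Sum>i\<le>m. a i / real (Suc i) * (real (Suc i) * u ^ i)) = p u"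
        unfolding a by (intro sum.cong refl) simp
      ultimately show ?thesis by simp
    qed
    have trig: "trig_pair (\<lambda>x. P (R n * sin (x / R n))) (\<lambda>x. p (R n * sin (x / R n)) * cos (x / R n))"
      using trig_pair_sine_polynomial[of "R n" c "Suc m" p] P_deriv R[of n] unfolding P_def[abs_def] by auto
    have range: "R n * sin (x / R n) \<in> {- R n..R n}" for x
      using R[of n] mult_left_mono[OF sin_le_one, of "R n" "x / R n"] mult_left_mono[OF sin_ge_minus_one, of "R n" "x / R n"]
      by auto
    have near: "\<bar>P u - H u\<bar> \<le> 1 / R n" if u: "u \<in> {- R n..R n}" for u
    proof -
      have "norm ((P u - H u) - (P 0 - H 0)) \<le> 1 / (R n)\<^sup>2 * norm (u - 0)"
      proof (rule field_differentiable_bound[where S="{- R n..R n}" and f'="\<lambda>u. p u - H' u"])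
        fix v assume v: "v \<in> {- R n..R n}"
        show "((\<lambda>u. P u - H u) has_field_derivative p v - H' v) (at v within {- R n..R n})"
          by (intro derivative_intros DERIV_subset[OF P_deriv] DERIV_subset[OF deriv]) auto
        show "norm (p v - H' v) \<le> 1 / (R n)\<^sup>2" using p(2)[OF v] by auto
      qed (use u R[of n] in auto)
      moreover have "P 0 = H 0" by (simp add: P_eq)
      moreover have "1 / (R n)\<^sup>2 * \<bar>u\<bar> \<le> 1 / (R n)\<^sup>2 * R n"
        using u by (intro mult_left_mono) auto
      ultimately show ?thesis using R[of n] by (simp add: power2_eq_square)
    qed
    have "\<bar>p u * cos (x / R n) - H' u * cos (x / R n)\<bar> \<le> 1 / R n" if u: "u \<in> {- R n..R n}" for u x
    proof -
      have "\<bar>p u * cos (x / R n) - H' u * cos (x / R n)\<bar> = \<bar>p u - H' u\<bar> * \<bar>cos (x / R n)\<bar>"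
        by (simp flip: left_diff_distrib abs_mult)
      also have "\<dots> \<le> 1 / (R n)\<^sup>2 * 1" using p(2)[OF u] by (intro mult_mono) auto
      also have "\<dots> \<le> 1 / R n" using R[of n] by (simp add: power2_eq_square field_simps)
      finally show ?thesis .
    qed
    then show ?thesis using trig near range by blast
  qed
  then obtain h h' where trig: "\<And>n. trig_pair (h n) (h' n)"
    and h: "\<And>n x. \<bar>h n x - H (R n * sin (x / R n))\<bar> \<le> 1 / R n"
    and h': "\<And>n x. \<bar>h' n x - H' (R n * sin (x / R n)) * cos (x / R n)\<bar> \<le> 1 / R n"
    by metis
  have R1: "1 / R n \<le> 1" for n using R[of n] by simp
  have R_lim: "(\<lambda>n. 1 / R n) \<longlonglongrightarrow> 0" unfolding R_def using LIMSEQ_inverse_real_of_nat by (simp add: inverse_eq_divide)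
  have xR: "(\<lambda>n. x / R n) \<longlonglongrightarrow> 0" for x using tendsto_mult[OF tendsto_const[of x] R_lim] by simp
  have sin_lim: "(\<lambda>n. R n * sin (x / R n)) \<longlonglongrightarrow> x" for x
  proof -
    have "R n * sin (x / R n) = x * sinc (x / R n)" for n
      using R[of n] by auto
    moreover have "(\<lambda>n. x * sinc (x / R n)) \<longlonglongrightarrow> x * sinc 0"
      by (intro tendsto_intros isCont_tendsto_compose[OF isCont_sinc] xR)
    ultimately show ?thesis by simp
  qed
  have cos_lim: "(\<lambda>n. cos (x / R n)) \<longlonglongrightarrow> 1" for x
    using isCont_tendsto_compose[OF isCont_cos xR] by simp
  have close: "f \<longlonglongrightarrow> l" if "g \<longlonglongrightarrow> l" "\<And>n. \<bar>f n - g n\<bar> \<le> 1 / R n" for f g :: "nat \<Rightarrow> real" and l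
  proof -
    have "(\<lambda>n. f n - g n) \<longlonglongrightarrow> 0"
      by (rule tendsto_rabs_zero_cancel, rule tendsto_sandwich[OF _ _ tendsto_const R_lim]) (auto simp: that)
    from tendsto_add[OF this that(1)] show ?thesis by simp
  qed
  show ?thesis
  proof (rule that[OF trig])
    show "\<bar>h n x\<bar> \<le> K + 1" for n x
      using h[of n x] bound(1)[of "R n * sin (x / R n)"] R1[of n] by linarith
    show "\<bar>h' n x\<bar> \<le> K + 1" for n x
    proof -
      have "\<bar>H' (R n * sin (x / R n)) * cos (x / R n)\<bar> \<le> K * 1"
        unfolding abs_mult using bound(2) by (intro mult_mono) (auto intro: order_trans[OF abs_ge_zero])
      then show ?thesis using h'[of n x] R1[of n] by linarith
    qed
    show "(\<lambda>n. h n x) \<longlonglongrightarrow> H x" for x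
      by (rule close[OF _ h]) (intro isCont_tendsto_compose[OF DERIV_isCont[OF deriv]] sin_lim)
    have "isCont H' x" for x using cont by (simp add: continuous_on_eq_continuous_at)
    then have "(\<lambda>n. H' (R n * sin (x / R n)) * cos (x / R n)) \<longlonglongrightarrow> H' x * 1" for x
      by (intro tendsto_mult cos_lim isCont_tendsto_compose[OF _ sin_lim]) 
    then show "(\<lambda>n. h' n x) \<longlonglongrightarrow> H' x" for x
      using close[OF _ h'] by simp
  qed
qed

lemma abs_prod_le_power:
  fixes f :: "'i \<Rightarrow> real"
  assumes "\<And>i. i \<in> I \<Longrightarrow> \<bar>f i\<bar> \<le> L"
  shows "\<bar>\<Prod>i\<in>I. f i\<bar> \<le> L ^ card I"
proof -
  have "(\<Prod>i\<in>I. \<bar>f i\<bar>) \<le> (\<Prod>i\<in>I. L)" using assms by (intro prod_mono) auto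
  then show ?thesis by (simp add: abs_prod)
qed

text \<open>The integrated form of the derivative formula is stable under bounded pointwise convergence, so it
  extends from trigonometric polynomials by dominated convergence, in \<open>\<omega>\<close> and then in \<open>s\<close>.\<close>

lemma gaussian_interpolation:
  fixes X :: "real \<Rightarrow> 'i \<Rightarrow> 'w \<Rightarrow> real" and C D :: "'i \<Rightarrow> 'i \<Rightarrow> real"
  assumes I: "finite I"
    and X: "\<And>s. 0 \<le> s \<Longrightarrow> s \<le> 1 \<Longrightarrow> gaussian_vector M I (X s) (\<lambda>i j. (1 - s) * D i j + s * C i j)"
    and diag: "\<And>i. i \<in> I \<Longrightarrow> C i i = D i i"
    and deriv: "\<And>x. (H has_real_derivative H' x) (at x)"
    and cont: "continuous_on UNIV H'"
    and bound: "\<And>x. \<bar>H x\<bar> \<le> K" "\<And>x. \<bar>H' x\<bar> \<le> K"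
  shows "((\<lambda>s. \<Sum>i\<in>I. \<Sum>j\<in>I - {i}. (C i j - D i j) / 2 *
      (\<integral>\<omega>. H' (X s i \<omega>) * H' (X s j \<omega>) * (\<Prod>k\<in>I - {i, j}. H (X s k \<omega>)) \<partial>M))
    has_integral (\<integral>\<omega>. (\<Prod>i\<in>I. H (X 1 i \<omega>)) \<partial>M) - (\<integral>\<omega>. (\<Prod>i\<in>I. H (X 0 i \<omega>)) \<partial>M)) {0..1}"
proof -
  obtain h h' where trig: "\<And>n. trig_pair (h n) (h' n)"
    and hb: "\<And>n x. \<bar>h n x\<bar> \<le> K + 1" "\<And>n x. \<bar>h' n x\<bar> \<le> K + 1"
    and lim: "\<And>x. (\<lambda>n. h n x) \<longlonglongrightarrow> H x" "\<And>x. (\<lambda>n. h' n x) \<longlonglongrightarrow> H' x"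
    using C1_trig_approximation[OF deriv cont bound] by blast
  define L where "L = K + 1"
  have L: "0 \<le> L" using bound(1)[of 0] by (simp add: L_def)
  interpret prob_space M using X[of 0] by (simp add: gaussian_vector_def)
  have Xm: "X s i \<in> borel_measurable M" if "s \<in> {0..1}" "i \<in> I" for s i
    using X[of s] that by (auto simp: gaussian_vector_def)
  have trig_m: "h n \<in> borel_measurable borel" "h' n \<in> borel_measurable borel" for n
  proof -
    obtain N :: nat and b :: "nat \<Rightarrow> complex" and \<kappa> :: "nat \<Rightarrow> real"
      where eq: "\<And>x. complex_of_real (h n x) = (\<Sum>k\<le>N. b k * cis (\<kappa> k * x))"
        "\<And>x. complex_of_real (h' n x) = (\<Sum>k\<le>N. \<i> * \<kappa> k * b k * cis (\<kappa> k * x))"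
      using trig[of n] unfolding trig_pair_def by blast
    have "h n = (\<lambda>x. Re (\<Sum>k\<le>N. b k * cis (\<kappa> k * x)))"
      "h' n = (\<lambda>x. Re (\<Sum>k\<le>N. \<i> * \<kappa> k * b k * cis (\<kappa> k * x)))"
      unfolding eq[symmetric] by auto
    then show "h n \<in> borel_measurable borel" "h' n \<in> borel_measurable borel"
      by (auto intro!: borel_measurable_continuous_onI continuous_intros)
  qed
  have Hm: "H \<in> borel_measurable borel" "H' \<in> borel_measurable borel"
    using borel_measurable_LIMSEQ_metric[OF trig_m(1) lim(1)] borel_measurable_LIMSEQ_metric[OF trig_m(2) lim(2)]
    by auto
  define \<psi> where "\<psi> g g' s = (\<Sum>i\<in>I. \<Sum>j\<in>I - {i}. (C i j - D i j) / 2 *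
      (\<integral>\<omega>. g' (X s i \<omega>) * g' (X s j \<omega>) * (\<Prod>k\<in>I - {i, j}. g (X s k \<omega>)) \<partial>M))" for g g' s
  define \<phi> where "\<phi> g s = (\<integral>\<omega>. (\<Prod>i\<in>I. g (X s i \<omega>)) \<partial>M)" for g :: "real \<Rightarrow> real" and s
  have trig_int: "(\<psi> (h n) (h' n) has_integral \<phi> (h n) 1 - \<phi> (h n) 0) {0..1}" for n
    unfolding \<psi>_def \<phi>_def by (rule trig_interpolation[OF I X diag trig])
  have \<phi>_lim: "(\<lambda>n. \<phi> (h n) s) \<longlonglongrightarrow> \<phi> H s" if s: "s \<in> {0..1}" for s
    unfolding \<phi>_def
  proof (rule integral_dominated_convergence[where w="\<lambda>_. L ^ card I"])
    note [measurable] = Xm[OF s] trig_m Hm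
    show "(\<lambda>\<omega>. \<Prod>i\<in>I. H (X s i \<omega>)) \<in> borel_measurable M" by measurable
    show "(\<lambda>\<omega>. \<Prod>i\<in>I. h n (X s i \<omega>)) \<in> borel_measurable M" for n by measurable
    show "AE \<omega> in M. norm (\<Prod>i\<in>I. h n (X s i \<omega>)) \<le> L ^ card I" for n
      using hb(1) unfolding L_def real_norm_def by (intro AE_I2 abs_prod_le_power) 
    show "AE \<omega> in M. (\<lambda>n. \<Prod>i\<in>I. h n (X s i \<omega>)) \<longlonglongrightarrow> (\<Prod>i\<in>I. H (X s i \<omega>))"
      by (intro AE_I2 tendsto_prod lim)
  qed simp
  define P where "P g g' i j s \<omega> = g' (X s i \<omega>) * g' (X s j \<omega>) * (\<Prod>k\<in>I - {i, j}. g (X s k \<omega>))" for g g' :: "real \<Rightarrow> real" and i j s \<omega>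
  have P_bound: "\<bar>P (h n) (h' n) i j s \<omega>\<bar> \<le> L * L * L ^ card (I - {i, j})" for n i j s \<omega>
    unfolding P_def abs_mult using hb L
    by (intro mult_mono abs_prod_le_power) (auto simp: L_def)
  have P_m: "P g g' i j s \<in> borel_measurable M"
    if "s \<in> {0..1}" "i \<in> I" "j \<in> I" "g \<in> borel_measurable borel" "g' \<in> borel_measurable borel" for g g' i j s
  proof -
    note [measurable] = Xm[OF that(1)] that(4,5)
    show ?thesis unfolding P_def using that(2,3) by measurable
  qed
  have \<psi>_lim: "(\<lambda>n. \<psi> (h n) (h' n) s) \<longlonglongrightarrow> \<psi> H H' s" if s: "s \<in> {0..1}" for s
    unfolding \<psi>_def P_def[symmetric]
  proof (intro tendsto_sum tendsto_mult_left)
    fix i j assume ij: "i \<in> I" "j \<in> I - {i}"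
    show "(\<lambda>n. \<integral>\<omega>. P (h n) (h' n) i j s \<omega> \<partial>M) \<longlonglongrightarrow> (\<integral>\<omega>. P H H' i j s \<omega> \<partial>M)"
    proof (rule integral_dominated_convergence[where w="\<lambda>_. L * L * L ^ card (I - {i, j})"])
      show "P H H' i j s \<in> borel_measurable M" using P_m Hm s ij by auto
      show "P (h n) (h' n) i j s \<in> borel_measurable M" for n using P_m trig_m s ij by auto
      show "AE \<omega> in M. norm (P (h n) (h' n) i j s \<omega>) \<le> L * L * L ^ card (I - {i, j})" for n
        unfolding real_norm_def by (intro AE_I2 P_bound)
      show "AE \<omega> in M. (\<lambda>n. P (h n) (h' n) i j s \<omega>) \<longlonglongrightarrow> P H H' i j s \<omega>"
        unfolding P_def by (intro AE_I2 tendsto_intros lim)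
    qed simp
  qed
  define W where "W = (\<Sum>i\<in>I. \<Sum>j\<in>I - {i}. \<bar>(C i j - D i j) / 2\<bar> * (L * L * L ^ card (I - {i, j})))"
  have \<psi>_bound: "\<bar>\<psi> (h n) (h' n) s\<bar> \<le> W" if s: "s \<in> {0..1}" for n s
    unfolding \<psi>_def P_def[symmetric] W_def
  proof (intro order_trans[OF sum_abs] sum_mono)
    fix i j assume ij: "i \<in> I" "j \<in> I - {i}"
    have "integrable M (P (h n) (h' n) i j s)"
      using P_bound[of n i j s] P_m trig_m s ij
      by (intro integrable_const_bound[where B="L * L * L ^ card (I - {i, j})"]) auto
    then have "\<bar>\<integral>\<omega>. P (h n) (h' n) i j s \<omega> \<partial>M\<bar> \<le> (\<integral>\<omega>. L * L * L ^ card (I - {i, j}) \<partial>M)"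
      by (intro order_trans[OF integral_abs_bound] integral_mono P_bound) auto
    then show "\<bar>(C i j - D i j) / 2 * (\<integral>\<omega>. P (h n) (h' n) i j s \<omega> \<partial>M)\<bar> \<le> \<bar>(C i j - D i j) / 2\<bar> * (L * L * L ^ card (I - {i, j}))"
      unfolding abs_mult[of "(C i j - D i j) / 2"] by (intro mult_left_mono) (auto simp: prob_space)
  qed
  have "\<psi> (h n) (h' n) integrable_on {0..1}" for n
    using trig_int by (rule has_integral_integrable)
  note conv = dominated_convergence[of "\<lambda>n. \<psi> (h n) (h' n)" "{0..1}" "\<lambda>_. W" "\<psi> H H'", OF this]
  have conv: "\<psi> H H' integrable_on {0..1}"
    "(\<lambda>n. integral {0..1} (\<psi> (h n) (h' n))) \<longlonglongrightarrow> integral {0..1} (\<psi> H H')"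
    using \<psi>_bound by (auto intro!: conv \<psi>_lim)
  have "(\<lambda>n. \<phi> (h n) 1 - \<phi> (h n) 0) \<longlonglongrightarrow> \<phi> H 1 - \<phi> H 0"
    by (intro tendsto_diff \<phi>_lim) auto
  moreover have "integral {0..1} (\<psi> (h n) (h' n)) = \<phi> (h n) 1 - \<phi> (h n) 0" for n
    using trig_int by (rule integral_unique)
  ultimately have "integral {0..1} (\<psi> H H') = \<phi> H 1 - \<phi> H 0"
    using conv(2) LIMSEQ_unique by auto
  then have "(\<psi> H H' has_integral \<phi> H 1 - \<phi> H 0) {0..1}"
    using integrable_integral[OF conv(1)] by simp
  then show ?thesis unfolding \<psi>_def \<phi>_def .
qed

section \<open>Comparison of Gaussian vectors\<close>

lemma gaussian_vector_independent_mix: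
  assumes X: "gaussian_vector M I X C" and Z: "gaussian_vector N I Z D" and ab: "\<And>i j. K i j = a\<^sup>2 * C i j + b\<^sup>2 * D i j"
  shows "gaussian_vector (M \<Otimes>\<^sub>M N) I (\<lambda>i w. a * X i (fst w) + b * Z i (snd w)) K"
proof -
  interpret M: prob_space M using X by (simp add: gaussian_vector_def)
  interpret N: prob_space N using Z by (simp add: gaussian_vector_def)
  interpret P: pair_prob_space M N ..
  have Xm [measurable]: "X i \<in> borel_measurable M" if "i \<in> I" for i
    using X that by (simp add: gaussian_vector_def)
  have Zm [measurable]: "Z i \<in> borel_measurable N" if "i \<in> I" for i
    using Z that by (simp add: gaussian_vector_def)
  have [measurable]: "cis \<in> borel_measurable borel"
    by (intro borel_measurable_continuous_onI continuous_intros)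
  have "(\<integral>w. cis (\<Sum>i\<in>I. \<xi> i * (a * X i (fst w) + b * Z i (snd w))) \<partial>(M \<Otimes>\<^sub>M N)) =
      complex_of_real (exp (- (\<Sum>i\<in>I. \<Sum>j\<in>I. \<xi> i * \<xi> j * K i j) / 2))" for \<xi>
  proof -
    have split: "cis (\<Sum>i\<in>I. \<xi> i * (a * X i x + b * Z i y)) =
      cis (\<Sum>i\<in>I. a * \<xi> i * X i x) * cis (\<Sum>i\<in>I. b * \<xi> i * Z i y)" for x y
      by (simp add: cis_mult distrib_left sum.distrib mult_ac)
    have "(\<integral>w. cis (\<Sum>i\<in>I. \<xi> i * (a * X i (fst w) + b * Z i (snd w))) \<partial>(M \<Otimes>\<^sub>M N)) =
       (\<integral>x. (\<integral>y. cis (\<Sum>i\<in>I. a * \<xi> i * X i x) * cis (\<Sum>i\<in>I. b * \<xi> i * Z i y) \<partial>N) \<partial>M)"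
      unfolding split
      by (subst P.integral_fst'[symmetric]) (auto intro!: P.integrable_const_bound[where B=1] simp: norm_mult)
    also have "\<dots> = (\<integral>x. cis (\<Sum>i\<in>I. a * \<xi> i * X i x) \<partial>M) * (\<integral>y. cis (\<Sum>i\<in>I. b * \<xi> i * Z i y) \<partial>N)"
      by simp
    also have "\<dots> = complex_of_real (exp (- (\<Sum>i\<in>I. \<Sum>j\<in>I. (a * \<xi> i) * (a * \<xi> j) * C i j) / 2) *
      exp (- (\<Sum>i\<in>I. \<Sum>j\<in>I. (b * \<xi> i) * (b * \<xi> j) * D i j) / 2))"
      using X Z unfolding gaussian_vector_def of_real_mult
      by (intro arg_cong2[where f="(*)"]) (auto elim: allE[of _ "\<lambda>i. a * \<xi> i"] allE[of _ "\<lambda>i. b * \<xi> i"])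
    also have "\<dots> = complex_of_real (exp (- (\<Sum>i\<in>I. \<Sum>j\<in>I. \<xi> i * \<xi> j * K i j) / 2))"
    proof -
      have "(\<Sum>i\<in>I. \<Sum>j\<in>I. \<xi> i * \<xi> j * K i j) =
        (\<Sum>i\<in>I. \<Sum>j\<in>I. (a * \<xi> i) * (a * \<xi> j) * C i j) + (\<Sum>i\<in>I. \<Sum>j\<in>I. (b * \<xi> i) * (b * \<xi> j) * D i j)"
        by (simp add: ab sum.distrib[symmetric] power2_eq_square algebra_simps)
      then show ?thesis by (simp add: exp_add[symmetric] add_divide_distrib diff_divide_distrib)
    qed
    finally show ?thesis .
  qed
  then show ?thesis
    unfolding gaussian_vector_def using P.prob_space_axioms by auto
qed

text \<open>The path \<open>\<surd>s X + \<surd>(1 - s) Z\<close> with \<open>X\<close> and \<open>Z\<close> independent has covariance \<open>s C + (1 - s) D\<close>.\<close>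

lemma gaussian_comparison:
  fixes X :: "'i \<Rightarrow> 'w \<Rightarrow> real" and Z :: "'i \<Rightarrow> 'v \<Rightarrow> real"
  assumes I: "finite I"
    and X: "gaussian_vector M I X C" and Z: "gaussian_vector N I Z D"
    and diag: "\<And>i. i \<in> I \<Longrightarrow> C i i = D i i"
    and deriv: "\<And>x. (H has_real_derivative H' x) (at x)"
    and cont: "continuous_on UNIV H'"
    and bound: "\<And>x. \<bar>H x\<bar> \<le> K" "\<And>x. \<bar>H' x\<bar> \<le> K"
  defines "XZ \<equiv> \<lambda>s i w. sqrt s * X i (fst w) + sqrt (1 - s) * Z i (snd w)"
  shows "((\<lambda>s. \<Sum>i\<in>I. \<Sum>j\<in>I - {i}. (C i j - D i j) / 2 *
      (\<integral>w. H' (XZ s i w) * H' (XZ s j w) * (\<Prod>k\<in>I - {i, j}. H (XZ s k w)) \<partial>(M \<Otimes>\<^sub>M N)))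
    has_integral (\<integral>\<omega>. (\<Prod>i\<in>I. H (X i \<omega>)) \<partial>M) - (\<integral>\<omega>. (\<Prod>i\<in>I. H (Z i \<omega>)) \<partial>N)) {0..1}"
proof -
  interpret M: prob_space M using X by (simp add: gaussian_vector_def)
  interpret N: prob_space N using Z by (simp add: gaussian_vector_def)
  interpret P: pair_prob_space M N ..
  have [measurable]: "X i \<in> borel_measurable M" if "i \<in> I" for i
    using X that by (simp add: gaussian_vector_def)
  have [measurable]: "Z i \<in> borel_measurable N" if "i \<in> I" for i
    using Z that by (simp add: gaussian_vector_def)
  have "continuous_on UNIV H"
    using DERIV_isCont[OF deriv] by (simp add: continuous_on_eq_continuous_at)
  then have Hm [measurable]: "H \<in> borel_measurable borel" by (rule borel_measurable_continuous_onI)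
  have path: "gaussian_vector (M \<Otimes>\<^sub>M N) I (XZ s) (\<lambda>i j. (1 - s) * D i j + s * C i j)" if "0 \<le> s" "s \<le> 1" for s
    unfolding XZ_def using that by (intro gaussian_vector_independent_mix[OF X Z]) simp
  have "(\<integral>w. (\<Prod>i\<in>I. H (XZ 1 i w)) \<partial>(M \<Otimes>\<^sub>M N)) = (\<integral>\<omega>. (\<Prod>i\<in>I. H (X i \<omega>)) \<partial>distr (M \<Otimes>\<^sub>M N) M fst)"
    unfolding XZ_def by (subst integral_distr) auto
  then have one: "(\<integral>w. (\<Prod>i\<in>I. H (XZ 1 i w)) \<partial>(M \<Otimes>\<^sub>M N)) = (\<integral>\<omega>. (\<Prod>i\<in>I. H (X i \<omega>)) \<partial>M)"
    by (simp add: N.distr_pair_fst)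
  have "(\<integral>w. (\<Prod>i\<in>I. H (XZ 0 i w)) \<partial>(M \<Otimes>\<^sub>M N)) = (\<integral>x. (\<integral>y. (\<Prod>i\<in>I. H (Z i y)) \<partial>N) \<partial>M)"
    unfolding XZ_def
    by (subst P.integral_fst'[symmetric])
       (auto intro!: P.integrable_const_bound[where B="K ^ card I"] abs_prod_le_power bound)
  then have zero: "(\<integral>w. (\<Prod>i\<in>I. H (XZ 0 i w)) \<partial>(M \<Otimes>\<^sub>M N)) = (\<integral>y. (\<Prod>i\<in>I. H (Z i y)) \<partial>N)"
    by (simp add: M.prob_space)
  show ?thesis
    using gaussian_interpolation[of I "M \<Otimes>\<^sub>M N" XZ D C H H' K, OF I path diag deriv cont bound]
    unfolding one zero .
qed

text \<open>For decreasing \<open>H\<close> the product \<open>H'(X\<^sub>i) H'(X\<^sub>j)\<close> is nonnegative, hence so is the derivative along the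
  path.\<close>

lemma gaussian_comparison_monotone:
  fixes X :: "'i \<Rightarrow> 'w \<Rightarrow> real" and Z :: "'i \<Rightarrow> 'v \<Rightarrow> real"
  assumes I: "finite I"
    and X: "gaussian_vector M I X C" and Z: "gaussian_vector N I Z D"
    and diag: "\<And>i. i \<in> I \<Longrightarrow> C i i = D i i"
    and le: "\<And>i j. i \<in> I \<Longrightarrow> j \<in> I \<Longrightarrow> i \<noteq> j \<Longrightarrow> D i j \<le> C i j"
    and deriv: "\<And>x. (H has_real_derivative H' x) (at x)"
    and cont: "continuous_on UNIV H'"
    and H: "\<And>x. 0 \<le> H x" "\<And>x. H x \<le> K"
    and H': "\<And>x. H' x \<le> 0" "\<And>x. - K \<le> H' x"
  shows "(\<integral>\<omega>. (\<Prod>i\<in>I. H (Z i \<omega>)) \<partial>N) \<le> (\<integral>\<omega>. (\<Prod>i\<in>I. H (X i \<omega>)) \<partial>M)"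
proof -
  have b: "\<bar>H x\<bar> \<le> K" "\<bar>H' x\<bar> \<le> K" for x
    using H[of x] H'[of x] order_trans[OF H(1)[of x] H(2)[of x]] by auto
  have "0 \<le> (\<integral>\<omega>. (\<Prod>i\<in>I. H (X i \<omega>)) \<partial>M) - (\<integral>\<omega>. (\<Prod>i\<in>I. H (Z i \<omega>)) \<partial>N)"
  proof (rule has_integral_nonneg[OF gaussian_comparison[OF I X Z diag deriv cont b]])
    fix s :: real
    let ?XZ = "\<lambda>i w. sqrt s * X i (fst w) + sqrt (1 - s) * Z i (snd w)"
    show "0 \<le> (\<Sum>i\<in>I. \<Sum>j\<in>I - {i}. (C i j - D i j) / 2 *
      (\<integral>w. H' (?XZ i w) * H' (?XZ j w) * (\<Prod>k\<in>I - {i, j}. H (?XZ k w)) \<partial>(M \<Otimes>\<^sub>M N)))"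
    proof (intro sum_nonneg)
      fix i j assume "i \<in> I" "j \<in> I - {i}"
      then have "0 \<le> (C i j - D i j) / 2" using le[of i j] by auto
      moreover have "0 \<le> (\<integral>w. H' (?XZ i w) * H' (?XZ j w) * (\<Prod>k\<in>I - {i, j}. H (?XZ k w)) \<partial>(M \<Otimes>\<^sub>M N))"
        by (intro integral_nonneg_AE AE_I2 mult_nonneg_nonneg[of "_ * _"] mult_nonpos_nonpos prod_nonneg H H')
      ultimately show "0 \<le> (C i j - D i j) / 2 * (\<integral>w. H' (?XZ i w) * H' (?XZ j w) * (\<Prod>k\<in>I - {i, j}. H (?XZ k w)) \<partial>(M \<Otimes>\<^sub>M N))"
        by (rule mult_nonneg_nonneg)
    qed
  qed simp
  then show ?thesis by simp
qed

text \<open>If \<open>|H'| \<le> H\<close>, then each expectation in the derivative is at most \<open>E \<Prod> H\<close> at the same point of the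
  path, which in turn is at most its value at the end of the path by
  \<open>gaussian_comparison_monotone\<close>.  So the whole increment is at most the total change of covariance
  times the final value.\<close>

lemma gaussian_comparison_reverse:
  fixes X :: "'i \<Rightarrow> 'w \<Rightarrow> real" and Z :: "'i \<Rightarrow> 'v \<Rightarrow> real"
  assumes I: "finite I"
    and X: "gaussian_vector M I X C" and Z: "gaussian_vector N I Z D"
    and diag: "\<And>i. i \<in> I \<Longrightarrow> C i i = D i i"
    and le: "\<And>i j. i \<in> I \<Longrightarrow> j \<in> I \<Longrightarrow> i \<noteq> j \<Longrightarrow> D i j \<le> C i j"
    and deriv: "\<And>x. (H has_real_derivative H' x) (at x)"
    and cont: "continuous_on UNIV H'"
    and H: "\<And>x. 0 \<le> H x" "\<And>x. H x \<le> K"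
    and H': "\<And>x. H' x \<le> 0" "\<And>x. - H x \<le> H' x"
  shows "(1 - (\<Sum>i\<in>I. \<Sum>j\<in>I - {i}. (C i j - D i j) / 2)) * (\<integral>\<omega>. (\<Prod>i\<in>I. H (X i \<omega>)) \<partial>M)
     \<le> (\<integral>\<omega>. (\<Prod>i\<in>I. H (Z i \<omega>)) \<partial>N)"
proof -
  have H'_K: "- K \<le> H' x" for x using H(2)[of x] H'(2)[of x] by linarith
  have b: "\<bar>H x\<bar> \<le> K" "\<bar>H' x\<bar> \<le> K" for x
    using H[of x] H'(1)[of x] H'_K[of x] order_trans[OF H(1)[of x] H(2)[of x]] by auto
  interpret M: prob_space M using X by (simp add: gaussian_vector_def)
  interpret N: prob_space N using Z by (simp add: gaussian_vector_def)
  interpret P: pair_prob_space M N ..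
  define XZ where "XZ s i w = sqrt s * X i (fst w) + sqrt (1 - s) * Z i (snd w)" for s i w
  have [measurable]: "X i \<in> borel_measurable M" if "i \<in> I" for i
    using X that by (simp add: gaussian_vector_def)
  have [measurable]: "Z i \<in> borel_measurable N" if "i \<in> I" for i
    using Z that by (simp add: gaussian_vector_def)
  have "continuous_on UNIV H"
    using DERIV_isCont[OF deriv] by (simp add: continuous_on_eq_continuous_at)
  then have [measurable]: "H \<in> borel_measurable borel" by (rule borel_measurable_continuous_onI)
  have [measurable]: "H' \<in> borel_measurable borel" using cont by (rule borel_measurable_continuous_onI)
  have XZm [measurable]: "XZ s i \<in> borel_measurable (M \<Otimes>\<^sub>M N)" if "i \<in> I" for s i
    unfolding XZ_def using that by measurable
  define p where "p = (\<integral>\<omega>. (\<Prod>i\<in>I. H (X i \<omega>)) \<partial>M)"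
  define W where "W = (\<Sum>i\<in>I. \<Sum>j\<in>I - {i}. (C i j - D i j) / 2)"
  have K0: "0 \<le> K" using order_trans[OF H(1) H(2)] .
  have pair: "(\<integral>w. H' (XZ s i w) * H' (XZ s j w) * (\<Prod>k\<in>I - {i, j}. H (XZ s k w)) \<partial>(M \<Otimes>\<^sub>M N)) \<le> p"
    if s: "s \<in> {0..1}" and ij: "i \<in> I" "j \<in> I - {i}" for s i j
  proof -
    have "(\<integral>w. H' (XZ s i w) * H' (XZ s j w) * (\<Prod>k\<in>I - {i, j}. H (XZ s k w)) \<partial>(M \<Otimes>\<^sub>M N))
      \<le> (\<integral>w. (\<Prod>k\<in>I. H (XZ s k w)) \<partial>(M \<Otimes>\<^sub>M N))"
    proof (rule integral_mono)
      show "integrable (M \<Otimes>\<^sub>M N) (\<lambda>w. H' (XZ s i w) * H' (XZ s j w) * (\<Prod>k\<in>I - {i, j}. H (XZ s k w)))"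
        using ij by (intro P.integrable_const_bound[where B="K * K * K ^ card (I - {i, j})"])
          (auto intro!: AE_I2 mult_mono abs_prod_le_power b K0 simp: abs_mult simp del: card_Diff_insert)
      show "integrable (M \<Otimes>\<^sub>M N) (\<lambda>w. \<Prod>k\<in>I. H (XZ s k w))"
        by (intro P.integrable_const_bound[where B="K ^ card I"]) (auto intro!: AE_I2 abs_prod_le_power b)
      fix w
      have "i \<noteq> j" and I_eq: "I = insert i (insert j (I - {i, j}))" using ij by auto
      have "(\<Prod>k\<in>I. H (XZ s k w)) = H (XZ s i w) * (H (XZ s j w) * (\<Prod>k\<in>I - {i, j}. H (XZ s k w)))"
        using I \<open>i \<noteq> j\<close> by (subst I_eq) simp
      moreover have "(- H' (XZ s i w)) * (- H' (XZ s j w)) \<le> H (XZ s i w) * H (XZ s j w)"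
        using H'(2)[of "XZ s i w"] H'(2)[of "XZ s j w"] H(1) H'(1) by (intro mult_mono) (auto simp: minus_le_iff)
      ultimately show "H' (XZ s i w) * H' (XZ s j w) * (\<Prod>k\<in>I - {i, j}. H (XZ s k w)) \<le> (\<Prod>k\<in>I. H (XZ s k w))"
        using mult_right_mono[of "H' (XZ s i w) * H' (XZ s j w)" "H (XZ s i w) * H (XZ s j w)" "\<Prod>k\<in>I - {i, j}. H (XZ s k w)"]
        by (simp add: prod_nonneg H mult.assoc)
    qed
    also have "\<dots> \<le> p"
      unfolding p_def
    proof (rule gaussian_comparison_monotone[OF I X _ _ _ deriv cont H H'(1) H'_K])
      show "gaussian_vector (M \<Otimes>\<^sub>M N) I (XZ s) (\<lambda>i j. (1 - s) * D i j + s * C i j)"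
        unfolding XZ_def using s by (intro gaussian_vector_independent_mix[OF X Z]) auto
      show "C i i = (1 - s) * D i i + s * C i i" if "i \<in> I" for i
        using diag[OF that] by (simp add: algebra_simps)
      show "(1 - s) * D i j + s * C i j \<le> C i j" if "i \<in> I" "j \<in> I" "i \<noteq> j" for i j
        using mult_left_mono[OF le[OF that], of "1 - s"] s by (simp add: algebra_simps)
    qed
    finally show ?thesis .
  qed
  have "p - (\<integral>\<omega>. (\<Prod>i\<in>I. H (Z i \<omega>)) \<partial>N) \<le> W * p"
  proof (rule has_integral_le)
    show "((\<lambda>s. \<Sum>i\<in>I. \<Sum>j\<in>I - {i}. (C i j - D i j) / 2 *
      (\<integral>w. H' (XZ s i w) * H' (XZ s j w) * (\<Prod>k\<in>I - {i, j}. H (XZ s k w)) \<partial>(M \<Otimes>\<^sub>M N)))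
      has_integral p - (\<integral>\<omega>. (\<Prod>i\<in>I. H (Z i \<omega>)) \<partial>N)) {0..1}"
      unfolding p_def XZ_def by (rule gaussian_comparison[OF I X Z diag deriv cont b])
    show "((\<lambda>_. W * p) has_integral W * p) {0..1::real}" using has_integral_const_real[of "W * p" 0 1] by simp
    show "(\<Sum>i\<in>I. \<Sum>j\<in>I - {i}. (C i j - D i j) / 2 *
      (\<integral>w. H' (XZ s i w) * H' (XZ s j w) * (\<Prod>k\<in>I - {i, j}. H (XZ s k w)) \<partial>(M \<Otimes>\<^sub>M N))) \<le> W * p"
      if "s \<in> {0..1}" for s
      unfolding W_def sum_distrib_right using le pair[OF that]
      by (intro sum_mono mult_left_mono) auto
  qed
  then show ?thesis unfolding W_def p_def by (simp add: algebra_simps)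
qed

text \<open>A decreasing \<open>C\<^sup>1\<close> majorant of the indicator of \<open>{..0}\<close>, equal to \<open>1\<close> there, which converges to the
  indicator as \<open>c \<rightarrow> \<infinity>\<close>; for \<open>c = 1\<close> its derivative is dominated by the function itself.\<close>

definition soft_step :: "real \<Rightarrow> real \<Rightarrow> real" where
  "soft_step c x = 1 / (1 + (c * max 0 x)\<^sup>2)"

definition soft_step' :: "real \<Rightarrow> real \<Rightarrow> real" where
  "soft_step' c x = - (2 * c\<^sup>2 * max 0 x) / (1 + (c * max 0 x)\<^sup>2)\<^sup>2"

lemma DERIV_max_0_square: "((\<lambda>x::real. (max 0 x)\<^sup>2) has_real_derivative 2 * max 0 x) (at x)"
proof (cases "x = 0")
  case True
  have "((\<lambda>h::real. (max 0 h)\<^sup>2 / h) \<longlongrightarrow> 0) (at 0)"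
  proof (rule tendsto_rabs_zero_cancel, rule tendsto_sandwich[OF _ _ tendsto_const])
    have "((\<lambda>h::real. \<bar>h\<bar>) \<longlongrightarrow> \<bar>0\<bar>) (at 0)" by (intro tendsto_intros)
    then show "((\<lambda>h::real. \<bar>h\<bar>) \<longlongrightarrow> 0) (at 0)" by simp
  qed (auto simp: max_def power2_eq_square)
  then show ?thesis unfolding True DERIV_def by simp
next
  case False
  show ?thesis
  proof (cases "x < 0")
    case True
    have "((\<lambda>x::real. 0) has_real_derivative 2 * max 0 x) (at x)" using True by simp
    then show ?thesis
      by (rule has_field_derivative_transform_within_open[where S="{..<0}"]) (use True in auto)
  next
    case F: False
    have "((\<lambda>x::real. x\<^sup>2) has_real_derivative 2 * max 0 x) (at x)"
      using F by (auto intro!: derivative_eq_intros)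
    then show ?thesis
      by (rule has_field_derivative_transform_within_open[where S="{0<..}"]) (use F False in auto)
  qed
qed

lemma soft_step_denominator: "0 < 1 + (c * y)\<^sup>2" for c y :: real
  by (rule add_pos_nonneg) auto

lemma DERIV_soft_step: "(soft_step c has_real_derivative soft_step' c x) (at x)"
proof -
  define f where "f x = 1 + c\<^sup>2 * (max 0 x)\<^sup>2" for x
  have f: "f x = 1 + (c * max 0 x)\<^sup>2" for x by (simp add: f_def power_mult_distrib)
  have "(f has_real_derivative c\<^sup>2 * (2 * max 0 x)) (at x)"
    unfolding f_def[abs_def] using DERIV_add[OF DERIV_const DERIV_cmult[OF DERIV_max_0_square]] by simp
  then have "((\<lambda>x. inverse (f x)) has_real_derivative - (c\<^sup>2 * (2 * max 0 x) * inverse (f x ^ Suc (Suc 0)))) (at x)"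
    by (rule DERIV_inverse_fun) (use soft_step_denominator[of c "max 0 x"] in \<open>simp add: f\<close>)
  then show ?thesis
    by (simp add: soft_step_def[abs_def] soft_step'_def f divide_inverse power2_eq_square mult_ac)
qed

lemma continuous_on_soft_step': "continuous_on UNIV (soft_step' c)"
  unfolding soft_step'_def using soft_step_denominator
  by (intro continuous_intros) (metis less_irrefl power_eq_0_iff)

lemma soft_step_bounds: "0 < soft_step c x" "soft_step c x \<le> 1"
  using soft_step_denominator[of c "max 0 x"] by (auto simp: soft_step_def)

lemma soft_step_nonpos: "x \<le> 0 \<Longrightarrow> soft_step c x = 1"
  by (simp add: soft_step_def max_def)

lemma soft_step'_bounds:
  assumes "0 \<le> c"
  shows "soft_step' c x \<le> 0" "- (c * soft_step c x) \<le> soft_step' c x"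
proof -
  show "soft_step' c x \<le> 0" by (simp add: soft_step'_def)
  define m where "m = c * max 0 x"
  define d where "d = 1 + m\<^sup>2"
  have d: "0 < d" unfolding d_def m_def by (rule soft_step_denominator)
  have "0 \<le> (m - 1)\<^sup>2" by simp
  then have md: "2 * m \<le> d" by (simp add: d_def power2_eq_square algebra_simps)
  have "2 * c\<^sup>2 * max 0 x / d\<^sup>2 = c * (2 * m / d) / d" using d by (simp add: m_def power2_eq_square field_simps)
  also have "\<dots> \<le> c * 1 / d"
    using d md assms by (intro divide_right_mono mult_left_mono) (auto simp: divide_le_eq)
  finally show "- (c * soft_step c x) \<le> soft_step' c x"
    by (simp add: soft_step_def soft_step'_def d_def m_def)
qed

lemma soft_step_tendsto: "(\<lambda>n. soft_step (real n) x) \<longlonglongrightarrow> indicator {..0} x"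
proof (cases "x \<le> 0")
  case True
  then show ?thesis by (simp add: soft_step_nonpos)
next
  case False
  have "filterlim (\<lambda>n. 1 + (real n * x)\<^sup>2) at_top sequentially"
    using False
    by (intro filterlim_tendsto_add_at_top[OF tendsto_const] filterlim_pow_at_top
      filterlim_at_top_mult_tendsto_pos[OF tendsto_const] filterlim_real_sequentially) auto
  then have "(\<lambda>n. inverse (1 + (real n * x)\<^sup>2)) \<longlonglongrightarrow> 0"
    by (rule tendsto_inverse_0_at_top)
  then show ?thesis using False by (simp add: soft_step_def max_def inverse_eq_divide)
qed

lemma soft_step_measurable [measurable]: "soft_step c \<in> borel_measurable borel"
  using DERIV_isCont[OF DERIV_soft_step]
  by (intro borel_measurable_continuous_onI) (simp add: continuous_on_eq_continuous_at)

lemma expectation_soft_step_tendsto: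
  assumes "prob_space M" "finite I" "\<And>i. i \<in> I \<Longrightarrow> X i \<in> borel_measurable M"
  shows "(\<lambda>n. \<integral>\<omega>. (\<Prod>i\<in>I. soft_step (real n) (X i \<omega>)) \<partial>M) \<longlonglongrightarrow> measure M {\<omega>\<in>space M. \<forall>i\<in>I. X i \<omega> \<le> 0}"
proof -
  interpret prob_space M by fact
  note [measurable] = assms(3)
  have "(\<lambda>n. \<integral>\<omega>. (\<Prod>i\<in>I. soft_step (real n) (X i \<omega>)) \<partial>M) \<longlonglongrightarrow>
    (\<integral>\<omega>. (\<Prod>i\<in>I. indicator {..0} (X i \<omega>)) \<partial>M)"
  proof (rule integral_dominated_convergence[where w="\<lambda>_. 1"])
    show "AE \<omega> in M. (\<lambda>n. \<Prod>i\<in>I. soft_step (real n) (X i \<omega>)) \<longlonglongrightarrow> (\<Prod>i\<in>I. indicator {..0} (X i \<omega>))"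
      by (intro AE_I2 tendsto_prod soft_step_tendsto)
    show "AE \<omega> in M. norm (\<Prod>i\<in>I. soft_step (real n) (X i \<omega>)) \<le> 1" for n
    proof (intro AE_I2)
      fix \<omega>
      have "\<bar>\<Prod>i\<in>I. soft_step (real n) (X i \<omega>)\<bar> \<le> 1 ^ card I"
        using soft_step_bounds by (intro abs_prod_le_power) (auto simp: abs_of_pos)
      then show "norm (\<Prod>i\<in>I. soft_step (real n) (X i \<omega>)) \<le> 1" by simp
    qed
  qed auto
  also have "(\<integral>\<omega>. (\<Prod>i\<in>I. indicator {..0} (X i \<omega>)) \<partial>M) = (LINT \<omega>|M. indicator {\<omega>\<in>space M. \<forall>i\<in>I. X i \<omega> \<le> 0} \<omega> :: real)"
  proof (rule Bochner_Integration.integral_cong[OF refl])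
    fix \<omega> assume "\<omega> \<in> space M"
    then show "(\<Prod>i\<in>I. indicator {..0} (X i \<omega>)) = (indicator {\<omega>\<in>space M. \<forall>i\<in>I. X i \<omega> \<le> 0} \<omega> :: real)"
      using assms(2) by (auto simp: indicator_def)
  qed
  also have "\<dots> = measure M {\<omega>\<in>space M. \<forall>i\<in>I. X i \<omega> \<le> 0}"
    using assms(2) by (simp add: Int_def conj_ac)
  finally show ?thesis .
qed

text \<open>Let \<open>c \<rightarrow> \<infinity>\<close> in the comparison of the expectations of products of \<open>soft_step c\<close>.\<close>

lemma slepian:
  fixes X :: "'i \<Rightarrow> 'w \<Rightarrow> real" and Z :: "'i \<Rightarrow> 'v \<Rightarrow> real"
  assumes I: "finite I"
    and X: "gaussian_vector M I X C" and Z: "gaussian_vector N I Z D"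
    and diag: "\<And>i. i \<in> I \<Longrightarrow> C i i = D i i"
    and le: "\<And>i j. i \<in> I \<Longrightarrow> j \<in> I \<Longrightarrow> i \<noteq> j \<Longrightarrow> D i j \<le> C i j"
  shows "measure N {\<omega>\<in>space N. \<forall>i\<in>I. Z i \<omega> \<le> 0} \<le> measure M {\<omega>\<in>space M. \<forall>i\<in>I. X i \<omega> \<le> 0}"
proof (rule LIMSEQ_le)
  show "(\<lambda>n. \<integral>\<omega>. (\<Prod>i\<in>I. soft_step (real n) (X i \<omega>)) \<partial>M) \<longlonglongrightarrow> measure M {\<omega>\<in>space M. \<forall>i\<in>I. X i \<omega> \<le> 0}"
    using X I by (intro expectation_soft_step_tendsto) (auto simp: gaussian_vector_def)
  show "(\<lambda>n. \<integral>\<omega>. (\<Prod>i\<in>I. soft_step (real n) (Z i \<omega>)) \<partial>N) \<longlonglongrightarrow> measure N {\<omega>\<in>space N. \<forall>i\<in>I. Z i \<omega> \<le> 0}"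
    using Z I by (intro expectation_soft_step_tendsto) (auto simp: gaussian_vector_def)
  have "(\<integral>\<omega>. (\<Prod>i\<in>I. soft_step (real n) (Z i \<omega>)) \<partial>N) \<le> (\<integral>\<omega>. (\<Prod>i\<in>I. soft_step (real n) (X i \<omega>)) \<partial>M)" for n
  proof (rule gaussian_comparison_monotone[of I M X C N Z D "soft_step (real n)" "soft_step' (real n)" "1 + real n",
      OF I X Z diag le DERIV_soft_step[of "real n"] continuous_on_soft_step'[of "real n"]])
    fix x
    show "0 \<le> soft_step (real n) x" "soft_step (real n) x \<le> 1 + real n"
      using soft_step_bounds[of "real n" x] by auto
    show "soft_step' (real n) x \<le> 0" using soft_step'_bounds(1)[of "real n" x] by simp
    have "real n * soft_step (real n) x \<le> real n" using soft_step_bounds[of "real n" x] by (simp add: mult_left_le)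
    then show "- (1 + real n) \<le> soft_step' (real n) x"
      using soft_step'_bounds(2)[of "real n" x] by simp
  qed
  then show "\<exists>N'. \<forall>n\<ge>N'. (\<integral>\<omega>. (\<Prod>i\<in>I. soft_step (real n) (Z i \<omega>)) \<partial>N) \<le> (\<integral>\<omega>. (\<Prod>i\<in>I. soft_step (real n) (X i \<omega>)) \<partial>M)"
    by blast
qed

section \<open>Gaussian fields with nonnegative covariance\<close>

lemma gaussian_rv_centered:
  assumes M: "prob_space M" and X: "gaussian_rv M X" and mean: "integral\<^sup>L M X = 0"
  shows "integrable M (\<lambda>\<omega>. (X \<omega>)\<^sup>2)"
    and "(\<integral>\<omega>. cis (X \<omega>) \<partial>M) = complex_of_real (exp (- (\<integral>\<omega>. (X \<omega>)\<^sup>2 \<partial>M) / 2))"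
proof -
  interpret prob_space M by fact
  have "integrable M (\<lambda>\<omega>. (X \<omega>)\<^sup>2) \<and>
    (\<integral>\<omega>. cis (X \<omega>) \<partial>M) = complex_of_real (exp (- (\<integral>\<omega>. (X \<omega>)\<^sup>2 \<partial>M) / 2))"
  proof (cases "\<exists>\<mu> \<sigma>. 0 < \<sigma> \<and> distributed M lborel X (normal_density \<mu> \<sigma>)")
    case True
    then obtain \<mu> \<sigma> where \<sigma>: "0 < \<sigma>" and D: "distributed M lborel X (normal_density \<mu> \<sigma>)" by blast
    have \<mu>: "\<mu> = 0" using normal_distributed_expectation[OF \<sigma> D] mean by simp
    have Xm [measurable]: "X \<in> borel_measurable M" using distributed_measurable[OF D] by simp
    have var: "(\<integral>\<omega>. (X \<omega>)\<^sup>2 \<partial>M) = \<sigma>\<^sup>2" using normal_distributed_variance[OF \<sigma> D] mean by simp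
    then have int: "integrable M (\<lambda>\<omega>. (X \<omega>)\<^sup>2)"
      using \<sigma> not_integrable_integral_eq by fastforce
    have D1: "distributed M lborel (\<lambda>\<omega>. X \<omega> / \<sigma>) std_normal_density"
      using D normal_standard_normal_convert[OF \<sigma>, of X \<mu>] by (simp add: \<mu>)
    then have dist: "distr M lborel (\<lambda>\<omega>. X \<omega> / \<sigma>) = std_normal_distribution"
      by (rule distributed_distr_eq_density)
    have "char std_normal_distribution \<sigma> = (\<integral>\<omega>. iexp (\<sigma> * (X \<omega> / \<sigma>)) \<partial>M)"
      unfolding char_def dist[symmetric] by (subst integral_distr) auto
    also have "\<dots> = (\<integral>\<omega>. cis (X \<omega>) \<partial>M)" using \<sigma> by (simp add: cis_conv_exp)
    finally show ?thesis using int var by (simp add: char_std_normal_distribution)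
  next
    case False
    then obtain c where Xm [measurable]: "X \<in> borel_measurable M" and c: "AE \<omega> in M. X \<omega> = c"
      using X unfolding gaussian_rv_def by blast
    have "integral\<^sup>L M X = (\<integral>\<omega>. c \<partial>M)" using c by (intro integral_cong_AE) auto
    then have "c = 0" using mean by (simp add: prob_space)
    then have z: "AE \<omega> in M. X \<omega> = 0" using c by simp
    have cis_m: "(\<lambda>\<omega>. cis (X \<omega>)) \<in> borel_measurable M"
      by (rule measurable_compose[OF Xm]) (intro borel_measurable_continuous_onI continuous_intros)
    have "(\<integral>\<omega>. (X \<omega>)\<^sup>2 \<partial>M) = (\<integral>\<omega>. 0 \<partial>M)" using z by (intro integral_cong_AE) auto
    moreover have "(\<integral>\<omega>. cis (X \<omega>) \<partial>M) = (\<integral>\<omega>. 1 \<partial>M)" using z cis_m by (intro integral_cong_AE) auto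
    moreover have "integrable M (\<lambda>\<omega>. (X \<omega>)\<^sup>2)"
      using z by (subst integrable_cong_AE[where g="\<lambda>_. 0"]) auto
    ultimately show ?thesis by (simp add: prob_space)
  qed
  then show "integrable M (\<lambda>\<omega>. (X \<omega>)\<^sup>2)"
    and "(\<integral>\<omega>. cis (X \<omega>) \<partial>M) = complex_of_real (exp (- (\<integral>\<omega>. (X \<omega>)\<^sup>2 \<partial>M) / 2))" by auto
qed

lemma integrable_mult_of_squares:
  fixes f g :: "'a \<Rightarrow> real"
  assumes [measurable]: "f \<in> borel_measurable M" "g \<in> borel_measurable M"
    and "integrable M (\<lambda>x. (f x)\<^sup>2)" "integrable M (\<lambda>x. (g x)\<^sup>2)"
  shows "integrable M (\<lambda>x. f x * g x)"
proof (rule Bochner_Integration.integrable_bound)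
  show "integrable M (\<lambda>x. (f x)\<^sup>2 + (g x)\<^sup>2)" using assms by auto
  have "\<bar>a * b\<bar> \<le> a\<^sup>2 + b\<^sup>2" for a b :: real
  proof -
    have "0 \<le> (\<bar>a\<bar> - \<bar>b\<bar>)\<^sup>2" by simp
    then have "2 * (\<bar>a\<bar> * \<bar>b\<bar>) \<le> a\<^sup>2 + b\<^sup>2" by (simp add: power2_diff)
    moreover have "0 \<le> \<bar>a\<bar> * \<bar>b\<bar>" by simp
    ultimately show ?thesis unfolding abs_mult by linarith
  qed
  then show "AE x in M. norm (f x * g x) \<le> norm ((f x)\<^sup>2 + (g x)\<^sup>2)" by auto
qed auto

lemma gaussian_vector_scale:
  assumes "gaussian_vector M I X C"
  shows "gaussian_vector M I (\<lambda>i \<omega>. c i * X i \<omega>) (\<lambda>i j. c i * c j * C i j)"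
proof -
  have "(\<integral>\<omega>. cis (\<Sum>i\<in>I. (\<xi> i * c i) * X i \<omega>) \<partial>M) =
     complex_of_real (exp (- (\<Sum>i\<in>I. \<Sum>j\<in>I. (\<xi> i * c i) * (\<xi> j * c j) * C i j) / 2))" for \<xi>
    using assms unfolding gaussian_vector_def by (auto elim: allE[of _ "\<lambda>i. \<xi> i * c i"])
  then show ?thesis
    using assms unfolding gaussian_vector_def by (auto simp: mult_ac)
qed

locale nonneg_gaussian_field =
  fixes M :: "'w measure" and Y :: "real ^ 'n \<Rightarrow> 'w \<Rightarrow> real" and B :: "real ^ 'n \<Rightarrow> real"
  assumes gaussian: "gaussian_field M Y" and centered: "centered_field M Y"
    and paths: "continuous_paths M Y" and cov: "homogeneous_cov M Y B"
    and B_nonneg: "\<And>t. B t \<ge> 0" and B_0: "B 0 = 1"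
begin

sublocale prob_space M using gaussian by (simp add: gaussian_field_def)

lemma Y_measurable [measurable]: "Y t \<in> borel_measurable M"
  using gaussian by (simp add: gaussian_field_def)

lemma integral_YY: "(\<integral>\<omega>. Y t \<omega> * Y s \<omega> \<partial>M) = B (t - s)"
  using cov by (simp add: homogeneous_cov_def)

lemma B_minus: "B (s - t) = B (t - s)"
  using integral_YY[of s t] integral_YY[of t s] by (simp add: mult.commute)

lemma gaussian_rv_sum: "finite F \<Longrightarrow> gaussian_rv M (\<lambda>\<omega>. \<Sum>t\<in>F. c t * Y t \<omega>)"
  using gaussian by (simp add: gaussian_field_def)

lemma gaussian_rv_Y: "gaussian_rv M (Y t)"
  using gaussian_rv_sum[of "{t}" "\<lambda>_. 1"] by simp

lemma mean_Y: "integral\<^sup>L M (Y t) = 0"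
  using centered by (simp add: centered_field_def)

lemma integrable_YY: "integrable M (\<lambda>\<omega>. Y t \<omega> * Y s \<omega>)"
  by (intro integrable_mult_of_squares gaussian_rv_centered(1)[OF prob_space_axioms gaussian_rv_Y mean_Y]) auto

lemma integrable_Y: "integrable M (Y t)"
  by (rule square_integrable_imp_integrable) (auto intro: integrable_YY simp: power2_eq_square)

lemma Y_standard_normal: "distributed M lborel (Y t) std_normal_density"
proof -
  have sq: "(\<integral>\<omega>. (Y t \<omega>)\<^sup>2 \<partial>M) = 1" using integral_YY[of t t] by (simp add: B_0 power2_eq_square)
  have "\<not> (AE \<omega> in M. Y t \<omega> = c)" for c
  proof
    assume c: "AE \<omega> in M. Y t \<omega> = c"
    have "integral\<^sup>L M (Y t) = (\<integral>\<omega>. c \<partial>M)" using c by (intro integral_cong_AE) auto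
    then have "c = 0" using mean_Y[of t] by (simp add: prob_space)
    then have "(\<integral>\<omega>. (Y t \<omega>)\<^sup>2 \<partial>M) = (\<integral>\<omega>. 0 \<partial>M)" using c by (intro integral_cong_AE) auto
    then show False using sq by simp
  qed
  then obtain \<mu> \<sigma> where \<sigma>: "0 < \<sigma>" and D: "distributed M lborel (Y t) (normal_density \<mu> \<sigma>)"
    using gaussian_rv_Y[of t] unfolding gaussian_rv_def by blast
  have "\<mu> = 0" using normal_distributed_expectation[OF \<sigma> D] mean_Y by simp
  moreover have "\<sigma>\<^sup>2 = 1" using normal_distributed_variance[OF \<sigma> D] mean_Y sq by simp
  then have "\<sigma> = 1" using \<sigma> by (simp add: power2_eq_1_iff)
  ultimately show ?thesis using D by simp
qed

text \<open>The index map \<open>f\<close> lets the same statement cover the field and its translates.\<close>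

lemma gaussian_vector_Y:
  fixes f :: "'i \<Rightarrow> real ^ 'n"
  assumes I: "finite I" and f: "inj_on f I"
  shows "gaussian_vector M I (\<lambda>i. Y (f i)) (\<lambda>i j. B (f i - f j))"
proof -
  have "(\<integral>\<omega>. cis (\<Sum>i\<in>I. \<xi> i * Y (f i) \<omega>) \<partial>M) =
       complex_of_real (exp (- (\<Sum>i\<in>I. \<Sum>j\<in>I. \<xi> i * \<xi> j * B (f i - f j)) / 2))" for \<xi>
  proof -
    define S where "S \<omega> = (\<Sum>i\<in>I. \<xi> i * Y (f i) \<omega>)" for \<omega>
    have "S = (\<lambda>\<omega>. \<Sum>t\<in>f ` I. \<xi> (the_inv_into I f t) * Y t \<omega>)"
      unfolding S_def using f by (simp add: sum.reindex the_inv_into_f_f)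
    then have "gaussian_rv M S" using gaussian_rv_sum[of "f ` I"] I by simp
    moreover have "integral\<^sup>L M S = 0"
      unfolding S_def by (subst Bochner_Integration.integral_sum) (auto intro: integrable_Y simp: mean_Y)
    ultimately have "(\<integral>\<omega>. cis (S \<omega>) \<partial>M) = complex_of_real (exp (- (\<integral>\<omega>. (S \<omega>)\<^sup>2 \<partial>M) / 2))"
      by (rule gaussian_rv_centered(2)[OF prob_space_axioms])
    also have "(\<lambda>\<omega>. (S \<omega>)\<^sup>2) = (\<lambda>\<omega>. \<Sum>i\<in>I. \<Sum>j\<in>I. \<xi> i * \<xi> j * (Y (f i) \<omega> * Y (f j) \<omega>))"
      unfolding S_def power2_eq_square sum_product by (simp add: mult_ac)
    also have "(\<integral>\<omega>. (\<Sum>i\<in>I. \<Sum>j\<in>I. \<xi> i * \<xi> j * (Y (f i) \<omega> * Y (f j) \<omega>)) \<partial>M) = (\<Sum>i\<in>I. \<Sum>j\<in>I. \<xi> i * \<xi> j * B (f i - f j))"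
      by (simp add: Bochner_Integration.integral_sum integrable_YY integral_YY)
    finally show ?thesis unfolding S_def .
  qed
  then show ?thesis unfolding gaussian_vector_def using prob_space_axioms by auto
qed

text \<open>On the product space, the field that follows one copy of \<open>Y\<close> on \<open>A\<close> and an independent copy off
  \<open>A\<close>: all correlations between \<open>A\<close> and its complement are removed, the others are kept.\<close>

definition decoupled :: "(real ^ 'n) set \<Rightarrow> real ^ 'n \<Rightarrow> 'w \<times> 'w \<Rightarrow> real" where
  "decoupled A t w = (if t \<in> A then Y t (fst w) else Y t (snd w))"

lemma gaussian_vector_decoupled:
  assumes "finite I"
  shows "gaussian_vector (M \<Otimes>\<^sub>M M) I (decoupled A)
    (\<lambda>s t. if s \<in> A \<longleftrightarrow> t \<in> A then B (s - t) else 0)"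
proof -
  note Y = gaussian_vector_scale[OF gaussian_vector_Y[OF assms inj_on_id2, simplified]]
  have "gaussian_vector (M \<Otimes>\<^sub>M M) I
    (\<lambda>t w. 1 * (indicator A t * Y t (fst w)) + 1 * (indicator (- A) t * Y t (snd w)))
    (\<lambda>s t. if s \<in> A \<longleftrightarrow> t \<in> A then B (s - t) else 0)"
    by (rule gaussian_vector_independent_mix[OF Y Y]) (auto simp: indicator_def)
  also have "(\<lambda>t w. 1 * (indicator A t * Y t (fst w)) + 1 * (indicator (- A) t * Y t (snd w))) = decoupled A"
    by (auto simp: decoupled_def fun_eq_iff indicator_def)
  finally show ?thesis .
qed

definition soft_prob :: "real \<Rightarrow> (real ^ 'n) set \<Rightarrow> real" where
  "soft_prob c A = (\<integral>\<omega>. (\<Prod>t\<in>A. soft_step c (Y t \<omega>)) \<partial>M)"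

lemma soft_prob_nonneg: "0 \<le> soft_prob c A"
  unfolding soft_prob_def by (intro integral_nonneg_AE AE_I2 prod_nonneg) (simp add: soft_step_bounds less_imp_le)

lemma abs_soft_step_le: "\<bar>soft_step c x\<bar> \<le> 1"
  using soft_step_bounds[of c x] by simp

lemma expectation_decoupled:
  assumes "finite A" "finite A'" "A \<inter> A' = {}"
  shows "(\<integral>w. (\<Prod>t\<in>A \<union> A'. soft_step c (decoupled A t w)) \<partial>(M \<Otimes>\<^sub>M M)) = soft_prob c A * soft_prob c A'"
proof -
  interpret P: pair_prob_space M M ..
  have [measurable]: "decoupled A t \<in> borel_measurable (M \<Otimes>\<^sub>M M)" for t
    unfolding decoupled_def by (cases "t \<in> A") auto
  have split: "(\<Prod>t\<in>A \<union> A'. soft_step c (decoupled A t (x, y))) =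
    (\<Prod>t\<in>A. soft_step c (Y t x)) * (\<Prod>t\<in>A'. soft_step c (Y t y))" for x y
    unfolding prod.union_disjoint[OF assms]
    by (intro arg_cong2[where f="(*)"] prod.cong refl) (use assms in \<open>auto simp: decoupled_def\<close>)
  have "integrable (M \<Otimes>\<^sub>M M) (\<lambda>w. \<Prod>t\<in>A \<union> A'. soft_step c (decoupled A t w))"
  proof (rule P.integrable_const_bound)
    show "AE w in M \<Otimes>\<^sub>M M. norm (\<Prod>t\<in>A \<union> A'. soft_step c (decoupled A t w)) \<le> 1 ^ card (A \<union> A')"
      unfolding real_norm_def by (intro AE_I2 abs_prod_le_power abs_soft_step_le)
  qed measurable
  from P.integral_fst'[OF this] show ?thesis
    by (simp add: split soft_prob_def)
qed

text \<open>Decoupling \<open>A\<close> from \<open>A'\<close> lowers the covariances, because \<open>B \<ge> 0\<close>.\<close>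

lemma soft_prob_union_ge:
  assumes "finite A" "finite A'" "A \<inter> A' = {}" and c: "0 \<le> c"
  shows "soft_prob c A * soft_prob c A' \<le> soft_prob c (A \<union> A')"
proof -
  have fin: "finite (A \<union> A')" using assms by simp
  show ?thesis
    unfolding expectation_decoupled[OF assms(1-3), symmetric]
    unfolding soft_prob_def
  proof (rule gaussian_comparison_monotone[OF fin gaussian_vector_Y[OF fin inj_on_id2] gaussian_vector_decoupled[OF fin] _ _
      DERIV_soft_step[of c] continuous_on_soft_step'[of c], where K="1 + c"])
    fix x
    show "0 \<le> soft_step c x" "soft_step c x \<le> 1 + c"
      using soft_step_bounds[of c x] c by auto
    show "soft_step' c x \<le> 0" using soft_step'_bounds(1)[OF c] .
    have "c * soft_step c x \<le> c" using soft_step_bounds[of c x] c by (simp add: mult_left_le)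
    then show "- (1 + c) \<le> soft_step' c x" using soft_step'_bounds(2)[OF c, of x] by simp
  qed (auto simp: B_nonneg)
qed

text \<open>Decoupling a single point \<open>t\<close> from \<open>A\<close> costs little when \<open>t\<close> is weakly correlated with \<open>A\<close> in total.\<close>

lemma soft_prob_insert_le:
  assumes A: "finite A" "t \<notin> A" and \<epsilon>: "(\<Sum>s\<in>A. B (t - s)) \<le> \<epsilon>"
  shows "(1 - \<epsilon>) * soft_prob 1 (insert t A) \<le> soft_prob 1 A * soft_prob 1 {t}"
proof -
  define I where "I = A \<union> {t}"
  define D where "D s u = (if s \<in> A \<longleftrightarrow> u \<in> A then B (s - u) else 0)" for s u
  have fin: "finite I" using A by (simp add: I_def)
  have disj: "A \<inter> {t} = {}" using A by auto
  have "(1 - (\<Sum>i\<in>I. \<Sum>j\<in>I - {i}. (B (i - j) - D i j) / 2)) * soft_prob 1 I \<le> soft_prob 1 A * soft_prob 1 {t}"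
    unfolding expectation_decoupled[OF A(1) finite.insertI[OF finite.emptyI] disj, symmetric] I_def[symmetric]
    unfolding soft_prob_def D_def
  proof (rule gaussian_comparison_reverse[OF fin gaussian_vector_Y[OF fin inj_on_id2] gaussian_vector_decoupled[OF fin] _ _
      DERIV_soft_step[of 1] continuous_on_soft_step'[of 1], where K=1])
    fix x
    show "0 \<le> soft_step 1 x" "soft_step 1 x \<le> 1"
      using soft_step_bounds[of 1 x] by auto
    show "soft_step' 1 x \<le> 0" "- soft_step 1 x \<le> soft_step' 1 x"
      using soft_step'_bounds[of 1 x] by auto
  qed (auto simp: B_nonneg)
  moreover have "(\<Sum>i\<in>I. \<Sum>j\<in>I - {i}. (B (i - j) - D i j) / 2) = (\<Sum>s\<in>A. B (t - s))"
  proof -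
    have "(\<Sum>j\<in>I - {i}. (B (i - j) - D i j) / 2) = B (t - i) / 2" if "i \<in> A" for i
    proof -
      have "(\<Sum>j\<in>I - {i}. (B (i - j) - D i j) / 2) = (\<Sum>j\<in>{t}. (B (i - j) - D i j) / 2)"
        using A that by (intro sum.mono_neutral_right) (auto simp: I_def D_def)
      then show ?thesis using A that by (simp add: D_def B_minus[of i t])
    qed
    then have "(\<Sum>i\<in>A. \<Sum>j\<in>I - {i}. (B (i - j) - D i j) / 2) = (\<Sum>i\<in>A. B (t - i) / 2)"
      by (rule sum.cong[OF refl])
    moreover have "(\<Sum>j\<in>I - {t}. (B (t - j) - D t j) / 2) = (\<Sum>j\<in>A. B (t - j) / 2)"
      using A by (intro sum.cong) (auto simp: I_def D_def)
    moreover have "(\<Sum>s\<in>A. B (t - s)) = (\<Sum>s\<in>A. B (t - s) / 2) + (\<Sum>s\<in>A. B (t - s) / 2)"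
      by (simp add: sum.distrib[symmetric])
    moreover have "(\<Sum>i\<in>I. f i) = f t + (\<Sum>i\<in>A. f i)" for f :: "real ^ 'n \<Rightarrow> real"
      using A by (simp add: I_def)
    ultimately show ?thesis by simp
  qed
  moreover have "(1 - \<epsilon>) * soft_prob 1 I \<le> (1 - (\<Sum>s\<in>A. B (t - s))) * soft_prob 1 I"
    using \<epsilon> soft_prob_nonneg by (intro mult_right_mono) auto
  ultimately have "(1 - \<epsilon>) * soft_prob 1 I \<le> soft_prob 1 A * soft_prob 1 {t}"
    by simp
  then show ?thesis by (simp add: I_def)
qed

end

section \<open>Supermultiplicativity and translation invariance of persistence\<close>

lemma finite_exhaustion:
  fixes S :: "'a::euclidean_space set"
  obtains F :: "nat \<Rightarrow> 'a set" where "incseq F" "\<And>n. finite (F n)" "\<Union> (range F) \<subseteq> S" "S \<subseteq> closure (\<Union> (range F))"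
proof -
  obtain T where T: "countable T" "T \<subseteq> S" "S \<subseteq> closure T" using separable[of S] by blast
  define F where "F n = (if T = {} then {} else from_nat_into T ` {..n})" for n
  have "\<Union> (range F) = T"
  proof (cases "T = {}")
    case False
    have "\<Union> (range F) = from_nat_into T ` UNIV" using False by (force simp: F_def)
    then show ?thesis using False T(1) range_from_nat_into by metis
  qed (simp add: F_def)
  moreover have "incseq F" by (auto simp: F_def incseq_def)
  moreover have "finite (F n)" for n by (simp add: F_def)
  ultimately show ?thesis using T that by metis
qed

context nonneg_gaussian_field
begin

abbreviation pers :: "(real ^ 'n) set \<Rightarrow> real" where
  "pers \<equiv> persistence_prob M Y"

lemma pers_bounds: "0 \<le> pers S" "pers S \<le> 1"
  by (simp_all add: persistence_prob_def)

lemma persistence_iff_dense: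
  assumes "D \<subseteq> S" "S \<subseteq> closure D" "\<omega> \<in> space M"
  shows "(\<forall>t\<in>S. Y t \<omega> \<le> 0) \<longleftrightarrow> (\<forall>t\<in>D. Y t \<omega> \<le> 0)"
proof
  assume "\<forall>t\<in>D. Y t \<omega> \<le> 0"
  then have "D \<subseteq> {t. Y t \<omega> \<le> 0}" by auto
  moreover have "closed {t. Y t \<omega> \<le> 0}"
    using paths assms(3) by (intro closed_Collect_le continuous_intros) (auto simp: continuous_paths_def)
  ultimately have "closure D \<subseteq> {t. Y t \<omega> \<le> 0}" by (rule closure_minimal)
  then show "\<forall>t\<in>S. Y t \<omega> \<le> 0" using assms by auto
qed (use assms in auto)

lemma persistence_event_dense:
  assumes "D \<subseteq> S" "S \<subseteq> closure D"
  shows "{\<omega>\<in>space M. \<forall>t\<in>S. Y t \<omega> \<le> 0} = {\<omega>\<in>space M. \<forall>t\<in>D. Y t \<omega> \<le> 0}"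
  using persistence_iff_dense[OF assms] by blast

lemma persistence_event [measurable]: "{\<omega>\<in>space M. \<forall>t\<in>S. Y t \<omega> \<le> 0} \<in> events"
proof -
  obtain T where T: "countable T" "T \<subseteq> S" "S \<subseteq> closure T" using separable[of S] by blast
  have "{\<omega>\<in>space M. \<forall>t\<in>T. Y t \<omega> \<le> 0} \<in> events"
    by (rule sets.sets_Collect_countable_All'[OF _ T(1)]) measurable
  then show ?thesis using persistence_event_dense[OF T(2,3)] by simp
qed

text \<open>By continuity of the paths, persistence on a dense subset is persistence on the whole set; this
  reduces statements about arbitrary sets to finite ones.\<close>

lemma pers_tendsto:
  assumes F: "incseq F" and dense: "\<Union> (range F) \<subseteq> S" "S \<subseteq> closure (\<Union> (range F))"
  shows "(\<lambda>n. pers (F n)) \<longlonglongrightarrow> pers S"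
proof -
  let ?E = "\<lambda>n. {\<omega>\<in>space M. \<forall>t\<in>F n. Y t \<omega> \<le> 0}"
  have "(\<lambda>n. prob (?E n)) \<longlonglongrightarrow> prob (\<Inter>n. ?E n)"
    using incseqD[OF F] by (intro finite_Lim_measure_decseq) (auto simp: decseq_def)
  also have "(\<Inter>n. ?E n) = {\<omega>\<in>space M. \<forall>t\<in>S. Y t \<omega> \<le> 0}"
    unfolding persistence_event_dense[OF dense] by auto
  finally show ?thesis by (simp add: persistence_prob_def)
qed

lemma pers_antimono: "S \<subseteq> S' \<Longrightarrow> pers S' \<le> pers S"
  unfolding persistence_prob_def by (intro finite_measure_mono) auto

text \<open>Points common to both sets are dropped from the second one, which only raises its probability.\<close>

lemma pers_finite_union:
  assumes "finite A" "finite A'"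
  shows "pers A * pers A' \<le> pers (A \<union> A')"
proof -
  have lim: "(\<lambda>n. soft_prob (real n) A) \<longlonglongrightarrow> pers A" if "finite A" for A
    unfolding soft_prob_def persistence_prob_def
    using prob_space_axioms that by (intro expectation_soft_step_tendsto) auto
  have "pers A * pers (A' - A) \<le> pers (A \<union> (A' - A))"
  proof (rule LIMSEQ_le)
    show "(\<lambda>n. soft_prob (real n) A * soft_prob (real n) (A' - A)) \<longlonglongrightarrow> pers A * pers (A' - A)"
      using assms by (intro tendsto_mult lim) auto
    show "(\<lambda>n. soft_prob (real n) (A \<union> (A' - A))) \<longlonglongrightarrow> pers (A \<union> (A' - A))"
      using assms by (intro lim) auto
    show "\<exists>N. \<forall>n\<ge>N. soft_prob (real n) A * soft_prob (real n) (A' - A) \<le> soft_prob (real n) (A \<union> (A' - A))"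
      using assms soft_prob_union_ge[of A "A' - A"] by auto
  qed
  moreover have "pers A * pers A' \<le> pers A * pers (A' - A)"
    by (intro mult_left_mono pers_antimono pers_bounds) auto
  ultimately show ?thesis by simp
qed

lemma pers_union: "pers S * pers S' \<le> pers (S \<union> S')"
proof -
  obtain F where F: "incseq F" "\<And>n. finite (F n)" "\<Union> (range F) \<subseteq> S" "S \<subseteq> closure (\<Union> (range F))"
    using finite_exhaustion[of S] by metis
  obtain F' where F': "incseq F'" "\<And>n. finite (F' n)" "\<Union> (range F') \<subseteq> S'" "S' \<subseteq> closure (\<Union> (range F'))"
    using finite_exhaustion[of S'] by metis
  have U: "\<Union> (range (\<lambda>n. F n \<union> F' n)) = \<Union> (range F) \<union> \<Union> (range F')" by auto
  show ?thesis
  proof (rule LIMSEQ_le)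
    show "(\<lambda>n. pers (F n) * pers (F' n)) \<longlonglongrightarrow> pers S * pers S'"
      by (intro tendsto_mult pers_tendsto F F')
    show "(\<lambda>n. pers (F n \<union> F' n)) \<longlonglongrightarrow> pers (S \<union> S')"
    proof (rule pers_tendsto)
      show "incseq (\<lambda>n. F n \<union> F' n)" using F(1) F'(1) unfolding incseq_def by blast
      show "\<Union> (range (\<lambda>n. F n \<union> F' n)) \<subseteq> S \<union> S'" unfolding U using F(3) F'(3) by auto
      show "S \<union> S' \<subseteq> closure (\<Union> (range (\<lambda>n. F n \<union> F' n)))" unfolding U closure_Un using F(4) F'(4) by auto
    qed
    show "\<exists>N. \<forall>n\<ge>N. pers (F n) * pers (F' n) \<le> pers (F n \<union> F' n)" using pers_finite_union F(2) F'(2) by blast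
  qed
qed

lemma pers_empty: "pers {} = 1" by (simp add: persistence_prob_def prob_space)

lemma pers_UNION: "finite K \<Longrightarrow> (\<Prod>k\<in>K. pers (S k)) \<le> pers (\<Union>k\<in>K. S k)"
proof (induction K rule: finite_induct)
  case (insert k K)
  have "(\<Prod>k\<in>insert k K. pers (S k)) \<le> pers (S k) * pers (\<Union>k\<in>K. S k)"
    using insert by (simp add: mult_left_mono pers_bounds)
  also have "\<dots> \<le> pers (\<Union>k\<in>insert k K. S k)" using pers_union by simp
  finally show ?case .
qed (simp add: pers_empty)

text \<open>Translates have the same covariances, so Slepian's inequality holds in both directions.\<close>

lemma pers_translate: "pers ((+) u ` S) = pers S"
proof -
  have fin: "pers ((+) u ` A) = pers A" if A: "finite A" for A
  proof -
    have "pers ((+) u ` A) = prob {\<omega>\<in>space M. \<forall>t\<in>A. Y (u + t) \<omega> \<le> 0}"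
      by (simp add: persistence_prob_def)
    moreover have V: "gaussian_vector M A (\<lambda>t. Y (u + t)) (\<lambda>s t. B (s - t))"
      using gaussian_vector_Y[OF A, of "(+) u"] by simp
    note W = gaussian_vector_Y[OF A inj_on_id2]
    have "prob {\<omega>\<in>space M. \<forall>t\<in>A. Y (u + t) \<omega> \<le> 0} = pers A"
      unfolding persistence_prob_def by (intro antisym slepian[OF A V W] slepian[OF A W V]) auto
    ultimately show ?thesis by simp
  qed
  obtain F where F: "incseq F" "\<And>n. finite (F n)" "\<Union> (range F) \<subseteq> S" "S \<subseteq> closure (\<Union> (range F))"
    using finite_exhaustion[of S] by metis
  have U: "\<Union> (range (\<lambda>n. (+) u ` F n)) = (+) u ` \<Union> (range F)" by auto
  have "(\<lambda>n. pers ((+) u ` F n)) \<longlonglongrightarrow> pers ((+) u ` S)"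
  proof (rule pers_tendsto)
    show "incseq (\<lambda>n. (+) u ` F n)" using F(1) unfolding incseq_def by blast
    show "\<Union> (range (\<lambda>n. (+) u ` F n)) \<subseteq> (+) u ` S" unfolding U using F(3) by auto
    show "(+) u ` S \<subseteq> closure (\<Union> (range (\<lambda>n. (+) u ` F n)))" unfolding U closure_translation using F(4) by auto
  qed
  moreover have "(\<lambda>n. pers ((+) u ` F n)) \<longlonglongrightarrow> pers S"
    using pers_tendsto[OF F(1,3,4)] F(2) by (simp add: fin)
  ultimately show ?thesis by (rule LIMSEQ_unique)
qed

lemma Y_not_AE_zero: "\<not> (AE \<omega> in M. Y t \<omega> = 0)"
proof
  assume "AE \<omega> in M. Y t \<omega> = 0"
  then have "(\<integral>\<omega>. Y t \<omega> * Y t \<omega> \<partial>M) = (\<integral>\<omega>. 0 \<partial>M)" by (intro integral_cong_AE) auto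
  then show False using integral_YY[of t t] by (simp add: B_0)
qed

lemma Y_not_AE_nonneg: "\<not> (AE \<omega> in M. 0 \<le> Y t \<omega>)"
  using Y_not_AE_zero integral_nonneg_eq_0_iff_AE[OF integrable_Y[of t]] mean_Y by auto

lemma Y_not_AE_nonpos: "\<not> (AE \<omega> in M. Y t \<omega> \<le> 0)"
  using Y_not_AE_zero[of t] integral_nonneg_eq_0_iff_AE[of M "\<lambda>\<omega>. - Y t \<omega>"] integrable_Y[of t] mean_Y[of t] by auto

text \<open>Since \<open>Y 0\<close> is negative with positive probability and the paths are continuous, a path that is
  negative at \<open>0\<close> is negative on some ball \<open>ball 0 (1 / n)\<close>; countably many radii suffice.\<close>

lemma pers_ball_pos: "\<exists>r>0. 0 < pers (ball 0 r)"
proof (rule ccontr)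
  assume neg: "\<not> ?thesis"
  let ?E = "\<lambda>n. {\<omega>\<in>space M. \<forall>t\<in>ball 0 (1 / real (Suc n)). Y t \<omega> \<le> 0}"
  have "pers (ball 0 (1 / real (Suc n))) = 0" for n
    using neg pers_bounds(1)[of "ball 0 (1 / real (Suc n))"] by (metis divide_pos_pos less_eq_real_def of_nat_0_less_iff zero_less_Suc zero_less_one)
  then have "prob (?E n) = 0" for n by (simp add: persistence_prob_def)
  then have "?E n \<in> null_sets M" for n
    by (intro null_setsI persistence_event) (simp add: emeasure_eq_measure)
  then have "AE \<omega> in M. \<forall>n. \<omega> \<notin> ?E n" unfolding AE_all_countable by (blast intro: AE_not_in)
  then have "AE \<omega> in M. 0 \<le> Y 0 \<omega>"
  proof (rule AE_mp, intro AE_I2 impI)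
    fix \<omega> assume \<omega>: "\<omega> \<in> space M" and notin: "\<forall>n. \<omega> \<notin> ?E n"
    show "0 \<le> Y 0 \<omega>"
    proof (rule ccontr)
      assume "\<not> 0 \<le> Y 0 \<omega>"
      moreover have "open {t. Y t \<omega> < 0}"
        using paths \<omega> by (intro open_Collect_less continuous_intros) (auto simp: continuous_paths_def)
      ultimately obtain e where e: "0 < e" "ball 0 e \<subseteq> {t. Y t \<omega> < 0}"
        by (auto elim!: openE[where x=0])
      obtain n where "1 / real (Suc n) < e" using e(1) nat_approx_posE by blast
      then have "ball 0 (1 / real (Suc n)) \<subseteq> {t. Y t \<omega> < 0}" using e(2) by (meson order_less_imp_le order_trans subset_ball)
      then have "\<omega> \<in> ?E n" using \<omega> by force
      then show False using notin by blast
    qed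
  qed
  then show False using Y_not_AE_nonneg by blast
qed

lemma pers_bounded_pos:
  assumes "bounded S"
  shows "0 < pers S"
proof -
  obtain r where r: "r > 0" "0 < pers (ball 0 r)" using pers_ball_pos by blast
  have "compact (closure S)" using assms by (simp add: compact_closure)
  then obtain K where K: "finite K" "closure S \<subseteq> (\<Union>x\<in>K. ball x r)"
    using r(1) unfolding compact_eq_totally_bounded by blast
  have "pers (ball x r) = pers (ball 0 r)" for x
    using pers_translate[of x "ball 0 r"] by (simp add: ball_translation[symmetric])
  then have "0 < pers (ball x r)" for x using r(2) by metis
  then have "0 < (\<Prod>x\<in>K. pers (ball x r))" by (intro prod_pos) blast
  also have "\<dots> \<le> pers (\<Union>x\<in>K. ball x r)" by (rule pers_UNION[OF K(1)])
  also have "\<dots> \<le> pers S" using K(2) closure_subset by (intro pers_antimono) blast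
  finally show ?thesis .
qed

section \<open>Exponential decay for integrable covariance\<close>

lemma soft_prob_singleton: "soft_prob c {t} = soft_prob c {0}"
proof -
  have "soft_prob c {t} = (\<integral>x. std_normal_density x * soft_step c x \<partial>lborel)" for t
    unfolding soft_prob_def
    by (subst distributed_integral[OF Y_standard_normal[of t]]) (auto simp: normal_density_nonneg)
  then show ?thesis by metis
qed

lemma integrable_soft_product: "finite A \<Longrightarrow> integrable M (\<lambda>\<omega>. \<Prod>t\<in>A. soft_step c (Y t \<omega>))"
proof (rule integrable_const_bound)
  show "AE \<omega> in M. norm (\<Prod>t\<in>A. soft_step c (Y t \<omega>)) \<le> 1 ^ card A"
    unfolding real_norm_def by (intro AE_I2 abs_prod_le_power abs_soft_step_le)
qed measurable

lemma soft_prob_singleton_less_1: "soft_prob 1 {0} < 1"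
proof -
  have int: "integrable M (\<lambda>\<omega>. soft_step 1 (Y 0 \<omega>))" using integrable_soft_product[of "{0}" 1] by simp
  have int2: "integrable M (\<lambda>\<omega>. 1 - soft_step 1 (Y 0 \<omega>))" using int by simp
  have eq: "(\<integral>\<omega>. 1 - soft_step 1 (Y 0 \<omega>) \<partial>M) = 1 - soft_prob 1 {0}"
    using int by (simp add: soft_prob_def prob_space)
  have nn: "0 \<le> (\<integral>\<omega>. 1 - soft_step 1 (Y 0 \<omega>) \<partial>M)"
    by (intro integral_nonneg_AE AE_I2) (simp add: soft_step_bounds)
  have "(\<integral>\<omega>. 1 - soft_step 1 (Y 0 \<omega>) \<partial>M) \<noteq> 0"
  proof
    assume "(\<integral>\<omega>. 1 - soft_step 1 (Y 0 \<omega>) \<partial>M) = 0"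
    then have "AE \<omega> in M. 1 - soft_step 1 (Y 0 \<omega>) = 0"
      by (subst (asm) integral_nonneg_eq_0_iff_AE[OF int2]) (auto simp: soft_step_bounds)
    moreover have "x \<le> 0" if "1 - soft_step 1 x = 0" for x :: real
      using that soft_step_denominator[of 1 "max 0 x"] by (auto simp: soft_step_def field_simps max_def split: if_splits)
    ultimately have "AE \<omega> in M. Y 0 \<omega> \<le> 0" by (auto elim: AE_mp)
    then show False using Y_not_AE_nonpos by blast
  qed
  then show ?thesis using eq nn by simp
qed

lemma pers_le_soft_prob:
  assumes "finite A" "A \<subseteq> S"
  shows "pers S \<le> soft_prob c A"
proof -
  let ?E = "{\<omega>\<in>space M. \<forall>t\<in>A. Y t \<omega> \<le> 0}"
  have "pers A = (\<integral>\<omega>. indicator ?E \<omega> \<partial>M)" by (simp add: persistence_prob_def Int_absorb2)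
  also have "\<dots> \<le> soft_prob c A"
    unfolding soft_prob_def
  proof (rule integral_mono)
    show "integrable M (indicator ?E :: _ \<Rightarrow> real)" by (intro integrable_real_indicator) (auto simp: emeasure_eq_measure)
    show "integrable M (\<lambda>\<omega>. \<Prod>t\<in>A. soft_step c (Y t \<omega>))" by (rule integrable_soft_product[OF assms(1)])
    show "indicator ?E \<omega> \<le> (\<Prod>t\<in>A. soft_step c (Y t \<omega>))" for \<omega>
      by (cases "\<omega> \<in> ?E") (auto simp: soft_step_nonpos soft_step_bounds less_imp_le intro!: prod_nonneg)
  qed
  finally show ?thesis using pers_antimono[OF assms(2)] by linarith
qed

text \<open>The average of \<open>t \<mapsto> \<Sum>\<^bsub>s \<in> A\<^esub> B (t - s)\<close> over \<open>S\<close> is at most \<open>card A \<cdot> \<integral> B / |S|\<close>.\<close>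

lemma exists_weakly_correlated_point:
  assumes B: "integrable lborel B" and S: "S \<in> sets lborel" "emeasure lborel S < \<infinity>"
    and A: "finite A" and small: "real (card A) * integral\<^sup>L lborel B < \<epsilon> * measure lborel S"
  shows "\<exists>t\<in>S. (\<Sum>s\<in>A. B (t - s)) \<le> \<epsilon>"
proof (rule ccontr)
  assume "\<not> ?thesis"
  then have large: "\<epsilon> \<le> (\<Sum>s\<in>A. B (t - s))" if "t \<in> S" for t using that by force
  have shift: "integrable lborel (\<lambda>t. B (t - s))" "(\<integral>t. B (t - s) \<partial>lborel) = integral\<^sup>L lborel B" for s
  proof -
    have Bm: "B \<in> borel_measurable borel" using B by auto
    have "integrable (distr lborel borel ((+) (- s))) B" using B by (simp add: lborel_distr_plus)
    then show "integrable lborel (\<lambda>t. B (t - s))" using Bm by (subst (asm) integrable_distr_eq) auto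
    have "integral\<^sup>L (distr lborel borel ((+) (- s))) B = (\<integral>t. B (- s + t) \<partial>lborel)"
      using Bm by (subst integral_distr) auto
    then show "(\<integral>t. B (t - s) \<partial>lborel) = integral\<^sup>L lborel B" by (simp add: lborel_distr_plus)
  qed
  have "\<epsilon> * measure lborel S = (\<integral>t. \<epsilon> * indicator S t \<partial>lborel)" using S by simp
  also have "\<dots> \<le> (\<integral>t. (\<Sum>s\<in>A. B (t - s)) \<partial>lborel)"
  proof (rule integral_mono)
    show "integrable lborel (\<lambda>t. \<epsilon> * indicator S t)" using S by (intro integrable_mult_right) auto
    show "integrable lborel (\<lambda>t. \<Sum>s\<in>A. B (t - s))" by (intro Bochner_Integration.integrable_sum shift)
    show "\<epsilon> * indicator S t \<le> (\<Sum>s\<in>A. B (t - s))" for t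
      using large[of t] by (cases "t \<in> S") (auto intro: sum_nonneg B_nonneg)
  qed
  also have "\<dots> = real (card A) * integral\<^sup>L lborel B"
    by (subst Bochner_Integration.integral_sum) (auto simp: shift)
  finally show False using small by simp
qed

text \<open>Choose the points one after another.  The truncated subtraction makes the smallness condition about
  the \<open>n - 1\<close> points present before the last step.  New points are automatically distinct from the old
  ones, since \<open>B 0 = 1 > \<epsilon>\<close>.\<close>

lemma exists_weakly_correlated_set:
  assumes B: "integrable lborel B" and S: "S \<in> sets lborel" "emeasure lborel S < \<infinity>"
    and \<epsilon>: "\<epsilon> < 1" and small: "real (n - 1) * integral\<^sup>L lborel B < \<epsilon> * measure lborel S"
  shows "\<exists>A\<subseteq>S. finite A \<and> card A = n \<and> soft_prob 1 A \<le> (soft_prob 1 {0} / (1 - \<epsilon>)) ^ n"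
  using small
proof (induction n)
  case 0
  show ?case by (intro exI[of _ "{}"]) (simp add: soft_prob_def prob_space)
next
  case (Suc n)
  have B0: "0 \<le> integral\<^sup>L lborel B" by (simp add: B_nonneg)
  have n: "real n * integral\<^sup>L lborel B < \<epsilon> * measure lborel S" using Suc.prems by simp
  have "real (n - 1) * integral\<^sup>L lborel B \<le> real n * integral\<^sup>L lborel B" using B0 by (intro mult_right_mono) auto
  then obtain A where A: "A \<subseteq> S" "finite A" "card A = n" and bound: "soft_prob 1 A \<le> (soft_prob 1 {0} / (1 - \<epsilon>)) ^ n"
    using Suc.IH n by fastforce
  obtain t where t: "t \<in> S" "(\<Sum>s\<in>A. B (t - s)) \<le> \<epsilon>"
    using exists_weakly_correlated_point[OF B S A(2)] n A(3) by auto
  have tA: "t \<notin> A"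
  proof
    assume "t \<in> A"
    then have "B (t - t) \<le> (\<Sum>s\<in>A. B (t - s))" using A(2) by (intro member_le_sum B_nonneg) auto
    then show False using t(2) \<epsilon> by (simp add: B_0)
  qed
  have "(1 - \<epsilon>) * soft_prob 1 (insert t A) \<le> soft_prob 1 A * soft_prob 1 {0}"
    using soft_prob_insert_le[OF A(2) tA t(2)] by (simp only: soft_prob_singleton[of 1 t])
  also have "\<dots> \<le> (soft_prob 1 {0} / (1 - \<epsilon>)) ^ n * soft_prob 1 {0}"
    by (intro mult_right_mono bound soft_prob_nonneg)
  finally have "soft_prob 1 (insert t A) \<le> (soft_prob 1 {0} / (1 - \<epsilon>)) ^ Suc n"
    using \<epsilon> by (simp add: pos_le_divide_eq mult_ac)
  then show ?case using A t(1) tA by (intro exI[of _ "insert t A"]) auto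
qed

text \<open>About \<open>\<eta> \<cdot> |S|\<close> weakly correlated points fit into \<open>S\<close>, and each contributes a factor \<open>r < 1\<close>.\<close>

lemma pers_exponential_bound:
  assumes B: "integrable lborel B"
  shows "\<exists>c>0. \<forall>S. S \<in> sets lborel \<longrightarrow> emeasure lborel S < \<infinity> \<longrightarrow> pers S \<le> exp (- c * measure lborel S)"
proof -
  define q where "q = soft_prob 1 {0}"
  \<comment> \<open>With this \<open>\<epsilon>\<close> the factor \<open>q / (1 - \<epsilon>)\<close> per point is still below \<open>1\<close>;
    \<open>b + 1\<close> and the lower bound \<open>1 / 2\<close> for \<open>r\<close> keep \<open>\<eta>\<close> and \<open>ln r\<close> meaningful when \<open>b = 0\<close> or \<open>q = 0\<close>.\<close>
  define \<epsilon> where "\<epsilon> = (1 - q) / 2"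
  define b where "b = integral\<^sup>L lborel B"
  define \<eta> where "\<eta> = \<epsilon> / (b + 1)"
  define r where "r = max (q / (1 - \<epsilon>)) (1 / 2)"
  have q: "0 \<le> q" "q < 1" unfolding q_def by (simp_all add: soft_prob_nonneg soft_prob_singleton_less_1)
  have \<epsilon>: "0 < \<epsilon>" "\<epsilon> < 1" using q by (auto simp: \<epsilon>_def)
  have b: "0 \<le> b" by (simp add: b_def B_nonneg)
  have \<eta>: "0 < \<eta>" "\<eta> * b < \<epsilon>" using \<epsilon> b by (auto simp: \<eta>_def field_simps)
  have r: "0 < r" "r < 1" using q by (auto simp: r_def \<epsilon>_def field_simps)
  have "pers S \<le> exp (- (- \<eta> * ln r) * measure lborel S)" if S: "S \<in> sets lborel" "emeasure lborel S < \<infinity>" for S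
  proof (cases "measure lborel S = 0")
    case True
    then show ?thesis using pers_bounds by simp
  next
    case False
    define V where "V = measure lborel S"
    have V: "0 < V" using False measure_nonneg[of lborel S] unfolding V_def by linarith
    define n where "n = nat \<lceil>\<eta> * V\<rceil>"
    have \<eta>V: "0 < \<eta> * V" using \<eta> V by simp
    have n: "\<eta> * V \<le> real n" "real (n - 1) \<le> \<eta> * V"
      using \<eta>V unfolding n_def by linarith+
    have "real (n - 1) * b \<le> \<eta> * V * b" using n(2) b by (rule mult_right_mono)
    also have "\<dots> < \<epsilon> * V" using mult_strict_right_mono[OF \<eta>(2) V] by (simp add: mult_ac)
    finally obtain A where A: "A \<subseteq> S" "finite A" "soft_prob 1 A \<le> (q / (1 - \<epsilon>)) ^ n"
      using exists_weakly_correlated_set[OF B S \<epsilon>(2)] unfolding b_def V_def q_def by blast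
    have "pers S \<le> soft_prob 1 A" by (rule pers_le_soft_prob[OF A(2,1)])
    also note A(3)
    also have "(q / (1 - \<epsilon>)) ^ n \<le> r ^ n"
      using q \<epsilon> by (intro power_mono) (auto simp: r_def)
    also have "r ^ n = exp (real n * ln r)" using r by (simp add: exp_of_nat_mult)
    also have "\<dots> \<le> exp (\<eta> * V * ln r)" using r n(1) by (simp add: mult_right_mono_neg)
    finally show ?thesis by (simp add: V_def mult_ac)
  qed
  moreover have "0 < - \<eta> * ln r" using \<eta> r by (simp add: mult_neg_pos mult_pos_neg)
  ultimately show ?thesis by blast
qed

end

section \<open>Lattice cubes\<close>

lemma lattice_cube_altdef:
  "lattice_cube \<delta> k = (\<Inter>i. {t. \<delta> * of_int (k $ i) \<le> t $ i} \<inter> {t. t $ i < \<delta> * (of_int (k $ i) + 1)})"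
  by (auto simp: lattice_cube_def)

lemma lattice_cube_borel: "lattice_cube \<delta> k \<in> sets borel"
  unfolding lattice_cube_altdef
  by (intro sets.finite_INT sets.Int borel_closed borel_open closed_Collect_le open_Collect_less continuous_intros) auto

lemma lattice_cube_between_boxes:
  fixes k :: "int ^ 'n" and \<delta> :: real
  defines "a \<equiv> (\<chi> i. \<delta> * of_int (k $ i))" and "b \<equiv> (\<chi> i. \<delta> * (of_int (k $ i) + 1))"
  shows "box a b \<subseteq> lattice_cube \<delta> k" "lattice_cube \<delta> k \<subseteq> cbox a b"
  by (auto simp: lattice_cube_def a_def b_def mem_box_cart less_imp_le)

lemma bounded_lattice_cube: "bounded (lattice_cube \<delta> k)"
  by (rule bounded_subset[OF bounded_cbox lattice_cube_between_boxes(2)])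

lemma emeasure_lattice_cube_finite: "emeasure lborel (lattice_cube \<delta> k) < \<infinity>"
  using bounded_lattice_cube by (rule emeasure_bounded_finite)

lemma measure_lattice_cube:
  fixes k :: "int ^ 'n"
  assumes "0 < \<delta>"
  shows "measure lborel (lattice_cube \<delta> k) = \<delta> ^ CARD('n)"
proof -
  define a b :: "real ^ 'n" where "a = (\<chi> i. \<delta> * of_int (k $ i))" and "b = (\<chi> i. \<delta> * (of_int (k $ i) + 1))"
  note sub = lattice_cube_between_boxes[of \<delta> k, folded a_def b_def]
  have "\<forall>i. a $ i \<le> b $ i" using assms by (simp add: a_def b_def)
  then have "cbox a b \<noteq> {}" by (simp add: interval_ne_empty_cart)
  then have "measure lborel (cbox a b) = (\<Prod>i\<in>UNIV. b $ i - a $ i)" by (rule content_cbox_cart)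
  then have c: "measure lborel (cbox a b) = \<delta> ^ CARD('n)"
    by (simp add: a_def b_def algebra_simps)
  have "measure lborel (box a b) = measure lborel (cbox a b)"
    by (simp add: measure_lborel_box_eq measure_lborel_cbox_eq)
  moreover have "measure lborel (box a b) \<le> measure lborel (lattice_cube \<delta> k)"
    using sub(1) lattice_cube_borel emeasure_lattice_cube_finite by (intro measure_mono_fmeasurable) (auto simp: fmeasurable_def)
  moreover have "measure lborel (lattice_cube \<delta> k) \<le> measure lborel (cbox a b)"
    using sub(2) lattice_cube_borel by (intro measure_mono_fmeasurable) (auto simp: fmeasurable_def emeasure_lborel_cbox_eq)
  ultimately show ?thesis using c by linarith
qed

lemma internal_volume_eq:
  fixes G :: "(real ^ 'n) set"
  assumes "0 < \<delta>"
  shows "internal_volume \<delta> G = real (card {k. lattice_cube \<delta> k \<subseteq> G}) * \<delta> ^ CARD('n)"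
  unfolding internal_volume_def by (simp add: lattice_cube_borel measure_lattice_cube[OF assms])

lemma external_volume_eq:
  fixes G :: "(real ^ 'n) set"
  assumes "0 < \<delta>"
  shows "external_volume \<delta> G = real (card {k. lattice_cube \<delta> k \<inter> G \<noteq> {}}) * \<delta> ^ CARD('n)"
  unfolding external_volume_def by (simp add: lattice_cube_borel measure_lattice_cube[OF assms])

lemma scale_lattice_cube:
  assumes "0 < T"
  shows "(*\<^sub>R) T ` lattice_cube \<delta> k = lattice_cube (T * \<delta>) k"
proof -
  have mem: "T *\<^sub>R t \<in> lattice_cube (T * \<delta>) k \<longleftrightarrow> t \<in> lattice_cube \<delta> k" for t
    using assms by (simp add: lattice_cube_def mult.assoc)
  show ?thesis
  proof (intro set_eqI iffI)
    fix t assume "t \<in> lattice_cube (T * \<delta>) k"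
    have t: "t = T *\<^sub>R ((1 / T) *\<^sub>R t)" using assms by simp
    then have "(1 / T) *\<^sub>R t \<in> lattice_cube \<delta> k"
      using mem[of "(1 / T) *\<^sub>R t"] \<open>t \<in> lattice_cube (T * \<delta>) k\<close> by simp
    then show "t \<in> (*\<^sub>R) T ` lattice_cube \<delta> k" using t by (intro image_eqI[where x="(1 / T) *\<^sub>R t"])
  qed (use mem in auto)
qed

lemma lattice_cube_translate:
  fixes k :: "int ^ 'n"
  shows "lattice_cube \<delta> k = (+) (\<chi> i. \<delta> * of_int (k $ i)) ` lattice_cube \<delta> 0"
proof (intro set_eqI iffI)
  fix t assume t: "t \<in> lattice_cube \<delta> k"
  have "t - (\<chi> i. \<delta> * of_int (k $ i)) \<in> lattice_cube \<delta> 0"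
    unfolding lattice_cube_def
  proof (intro CollectI allI)
    fix i
    have "\<delta> * of_int (k $ i) \<le> t $ i \<and> t $ i < \<delta> * of_int (k $ i) + \<delta>"
      using t by (simp add: lattice_cube_def distrib_left)
    then show "\<delta> * of_int ((0 :: int ^ 'n) $ i) \<le> (t - (\<chi> i. \<delta> * of_int (k $ i))) $ i \<and>
      (t - (\<chi> i. \<delta> * of_int (k $ i))) $ i < \<delta> * (of_int ((0 :: int ^ 'n) $ i) + 1)"
      by simp
  qed
  moreover have "t = (\<chi> i. \<delta> * of_int (k $ i)) + (t - (\<chi> i. \<delta> * of_int (k $ i)))" by simp
  ultimately show "t \<in> (+) (\<chi> i. \<delta> * of_int (k $ i)) ` lattice_cube \<delta> 0" by (rule image_eqI[rotated])
qed (auto simp: lattice_cube_def distrib_left)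

text \<open>The half-open cubes partition the space, and rounding down finds the cube of a point.\<close>

lemma lattice_cube_floor:
  assumes "0 < \<delta>"
  shows "t \<in> lattice_cube \<delta> k \<longleftrightarrow> k = (\<chi> i. \<lfloor>t $ i / \<delta>\<rfloor>)"
proof -
  have "t \<in> lattice_cube \<delta> k \<longleftrightarrow> (\<forall>i. \<lfloor>t $ i / \<delta>\<rfloor> = k $ i)"
    using assms by (simp add: lattice_cube_def floor_eq_iff field_simps)
  then show ?thesis by (auto simp: vec_eq_iff)
qed

definition index_box :: "nat \<Rightarrow> (int ^ 'n) set" where
  "index_box m = {k. \<forall>i. k $ i \<in> {- int m..<int m}}"

lemma card_index_box: "finite (index_box m :: (int ^ 'n) set)" "card (index_box m :: (int ^ 'n) set) = (2 * m) ^ CARD('n)"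
proof -
  have "bij_betw vec_nth (index_box m :: (int ^ 'n) set) (UNIV \<rightarrow>\<^sub>E {- int m..<int m})"
    by (rule bij_betw_byWitness[where f'="vec_lambda"]) (auto simp: index_box_def)
  then have "finite (index_box m :: (int ^ 'n) set) = finite ((UNIV :: 'n set) \<rightarrow>\<^sub>E {- int m..<int m})"
    and "card (index_box m :: (int ^ 'n) set) = card ((UNIV :: 'n set) \<rightarrow>\<^sub>E {- int m..<int m})"
    by (auto dest: bij_betw_finite bij_betw_same_card)
  moreover have "nat (2 * int m) = 2 * m" by simp
  ultimately show "finite (index_box m :: (int ^ 'n) set)" "card (index_box m :: (int ^ 'n) set) = (2 * m) ^ CARD('n)"
    by (simp_all add: finite_PiE card_funcsetE del: power_mult_distrib)
qed

lemma mem_lattice_cube_index_box: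
  assumes "0 < \<delta>" "t \<in> lattice_cube \<delta> k"
  shows "k \<in> index_box m \<longleftrightarrow> (\<forall>i. - (real m * \<delta>) \<le> t $ i \<and> t $ i < real m * \<delta>)"
proof -
  have k: "k = (\<chi> i. \<lfloor>t $ i / \<delta>\<rfloor>)" using lattice_cube_floor[OF assms(1)] assms(2) by (rule iffD1)
  have "\<lfloor>t $ i / \<delta>\<rfloor> \<in> {- int m..<int m} \<longleftrightarrow> - (real m * \<delta>) \<le> t $ i \<and> t $ i < real m * \<delta>" for i
  proof -
    have "\<lfloor>t $ i / \<delta>\<rfloor> \<in> {- int m..<int m} \<longleftrightarrow> - real m \<le> t $ i / \<delta> \<and> t $ i / \<delta> < real m"
      by (auto simp: le_floor_iff floor_less_iff)
    also have "\<dots> \<longleftrightarrow> - (real m * \<delta>) \<le> t $ i \<and> t $ i < real m * \<delta>" using assms(1) by (simp add: field_simps)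
    finally show ?thesis .
  qed
  then show ?thesis by (simp add: k index_box_def)
qed

lemma UN_index_box:
  assumes "0 < \<delta>"
  shows "(\<Union>k\<in>index_box m. lattice_cube \<delta> k) = {t :: real ^ 'n. \<forall>i. - (real m * \<delta>) \<le> t $ i \<and> t $ i < real m * \<delta>}"
proof (intro set_eqI iffI)
  fix t :: "real ^ 'n" assume t: "t \<in> {t. \<forall>i. - (real m * \<delta>) \<le> t $ i \<and> t $ i < real m * \<delta>}"
  have "t \<in> lattice_cube \<delta> (\<chi> i. \<lfloor>t $ i / \<delta>\<rfloor>)" by (simp add: lattice_cube_floor[OF assms])
  moreover from this have "(\<chi> i. \<lfloor>t $ i / \<delta>\<rfloor>) \<in> index_box m"
    using t by (simp add: mem_lattice_cube_index_box[OF assms])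
  ultimately show "t \<in> (\<Union>k\<in>index_box m. lattice_cube \<delta> k)" by blast
next
  fix t :: "real ^ 'n" assume "t \<in> (\<Union>k\<in>index_box m. lattice_cube \<delta> k)"
  then obtain k where "k \<in> index_box m" "t \<in> lattice_cube \<delta> k" by blast
  then show "t \<in> {t. \<forall>i. - (real m * \<delta>) \<le> t $ i \<and> t $ i < real m * \<delta>}"
    by (simp add: mem_lattice_cube_index_box[OF assms])
qed

lemma big_cube_translate:
  "{t :: real ^ 'n. \<forall>i. - a \<le> t $ i \<and> t $ i < a} = (+) (\<chi> i. - a) ` lattice_cube (2 * a) 0"
proof (intro set_eqI iffI)
  fix t :: "real ^ 'n" assume t: "t \<in> {t. \<forall>i. - a \<le> t $ i \<and> t $ i < a}"
  have "2 * a * of_int ((0 :: int ^ 'n) $ i) \<le> (t - (\<chi> i. - a)) $ i \<and>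
      (t - (\<chi> i. - a)) $ i < 2 * a * (of_int ((0 :: int ^ 'n) $ i) + 1)" for i
  proof -
    have "- a \<le> t $ i \<and> t $ i < a" using t by blast
    then show ?thesis by simp
  qed
  then have "t - (\<chi> i. - a) \<in> lattice_cube (2 * a) 0" unfolding lattice_cube_def by blast
  moreover have "t = (\<chi> i. - a) + (t - (\<chi> i. - a))" by simp
  ultimately show "t \<in> (+) (\<chi> i. - a) ` lattice_cube (2 * a) 0" by (rule image_eqI[rotated])
next
  fix t :: "real ^ 'n" assume "t \<in> (+) (\<chi> i. - a) ` lattice_cube (2 * a) 0"
  then obtain s where s: "s \<in> lattice_cube (2 * a) 0" and t: "t = (\<chi> i. - a) + s" by blast
  have "0 \<le> s $ i \<and> s $ i < 2 * a" for i using s by (simp add: lattice_cube_def)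
  then show "t \<in> {t. \<forall>i. - a \<le> t $ i \<and> t $ i < a}" by (simp add: t)
qed

context nonneg_gaussian_field
begin

section \<open>The limit\<close>

definition cost :: "(real ^ 'n) set \<Rightarrow> real" where
  "cost S = - ln (pers S)"

lemma cost_nonneg: "bounded S \<Longrightarrow> 0 \<le> cost S"
  using pers_bounds(2)[of S] pers_bounded_pos[of S] by (simp add: cost_def ln_le_zero_iff)

lemma cost_mono: "S \<subseteq> S' \<Longrightarrow> bounded S' \<Longrightarrow> cost S \<le> cost S'"
  unfolding cost_def using pers_antimono[of S S'] pers_bounded_pos[of S'] by simp

lemma cost_translate: "cost ((+) u ` S) = cost S"
  by (simp add: cost_def pers_translate)

lemma cost_UNION:
  assumes K: "finite K" and S: "\<And>k. k \<in> K \<Longrightarrow> bounded (S k)"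
  shows "cost (\<Union>k\<in>K. S k) \<le> (\<Sum>k\<in>K. cost (S k))"
proof -
  have pos: "0 < pers (S k)" if "k \<in> K" for k using pers_bounded_pos[OF S[OF that]] .
  then have "0 < (\<Prod>k\<in>K. pers (S k))" by (rule prod_pos)
  then have "ln (\<Prod>k\<in>K. pers (S k)) \<le> ln (pers (\<Union>k\<in>K. S k))" using pers_UNION[OF K, of S] by simp
  moreover have "ln (\<Prod>k\<in>K. pers (S k)) = (\<Sum>k\<in>K. ln (pers (S k)))" using K by (intro ln_prod) (auto dest: pos)
  ultimately show ?thesis by (simp add: cost_def sum_negf)
qed

lemma cost_union:
  assumes "bounded S" "bounded S'"
  shows "cost (S \<union> S') \<le> cost S + cost S'"
proof -
  have pos: "0 < pers S" "0 < pers S'" using assms by (simp_all add: pers_bounded_pos)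
  then have "0 < pers S * pers S'" by simp
  then have "ln (pers S * pers S') \<le> ln (pers (S \<union> S'))" using pers_union[of S S'] by simp
  then show ?thesis using pos by (simp add: cost_def ln_mult)
qed

definition cube_cost :: "real \<Rightarrow> real" where
  "cube_cost L = cost (lattice_cube L 0)"

lemma cost_lattice_cube: "cost (lattice_cube L k) = cube_cost L"
  unfolding cube_cost_def by (subst lattice_cube_translate) (rule cost_translate)

lemma cube_cost_nonneg: "0 \<le> cube_cost L"
  unfolding cube_cost_def by (intro cost_nonneg bounded_lattice_cube)

text \<open>The infimum is the limit of the cost per volume as \<open>L \<rightarrow> \<infinity>\<close>, as in Fekete's lemma.  Defining it as an infimum
  makes the lower bound for every cube immediate.\<close>

definition cube_rate :: real where
  "cube_rate = (INF L\<in>{0<..}. cube_cost L / L ^ CARD('n))"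

lemma bdd_below_cube_cost: "bdd_below ((\<lambda>L. cube_cost L / L ^ CARD('n)) ` {0<..})"
  by (rule bdd_belowI[where m=0]) (auto simp: cube_cost_nonneg)

lemma cube_rate_le: "0 < L \<Longrightarrow> cube_rate \<le> cube_cost L / L ^ CARD('n)"
  unfolding cube_rate_def using bdd_below_cube_cost by (intro cINF_lower) auto

lemma cube_rate_approx:
  assumes "0 < e"
  obtains L where "0 < L" "cube_cost L / L ^ CARD('n) < cube_rate + e"
proof -
  have "cube_rate < cube_rate + e" using assms by simp
  then show ?thesis using that bdd_below_cube_cost unfolding cube_rate_def by (subst (asm) cINF_less_iff) auto
qed

lemma finite_cubes_meeting:
  fixes G :: "(real ^ 'n) set"
  assumes "bounded G" "0 < \<delta>"
  shows "finite {k. lattice_cube \<delta> k \<inter> G \<noteq> {}}"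
proof -
  obtain R where R: "\<And>t. t \<in> G \<Longrightarrow> norm t \<le> R" using assms(1) by (auto simp: bounded_iff)
  obtain m where m: "R / \<delta> < real m" using reals_Archimedean2 by blast
  have "{k. lattice_cube \<delta> k \<inter> G \<noteq> {}} \<subseteq> index_box m"
  proof
    fix k assume "k \<in> {k. lattice_cube \<delta> k \<inter> G \<noteq> {}}"
    then obtain t where t: "t \<in> lattice_cube \<delta> k" "t \<in> G" by blast
    have "\<bar>t $ i\<bar> < real m * \<delta>" for i
      using component_le_norm_cart[of t i] R[OF t(2)] m assms(2) by (simp add: field_simps)
    then have "\<forall>i. - (real m * \<delta>) \<le> t $ i \<and> t $ i < real m * \<delta>" by (simp add: abs_less_iff less_imp_le minus_less_iff)
    then show "k \<in> index_box m" using mem_lattice_cube_index_box[OF assms(2) t(1)] by blast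
  qed
  then show ?thesis using card_index_box(1) by (rule finite_subset)
qed

text \<open>\<open>T G\<close> is covered by the cubes of side \<open>L\<close> that meet it.\<close>

lemma cost_scaled_upper:
  assumes G: "bounded G" and L: "0 < L" and T: "0 < T"
  shows "cost ((*\<^sub>R) T ` G) / T ^ CARD('n) \<le> external_volume (L / T) G * (cube_cost L / L ^ CARD('n))"
proof -
  define K where "K = {k. lattice_cube (L / T) k \<inter> G \<noteq> {}}"
  have \<delta>: "0 < L / T" using L T by simp
  have K: "finite K" unfolding K_def by (rule finite_cubes_meeting[OF G \<delta>])
  have "G \<subseteq> (\<Union>k\<in>K. lattice_cube (L / T) k)"
  proof
    fix t assume t: "t \<in> G"
    have "t \<in> lattice_cube (L / T) (\<chi> i. \<lfloor>t $ i / (L / T)\<rfloor>)" by (simp add: lattice_cube_floor[OF \<delta>])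
    then show "t \<in> (\<Union>k\<in>K. lattice_cube (L / T) k)" using t unfolding K_def by blast
  qed
  then have "(*\<^sub>R) T ` G \<subseteq> (\<Union>k\<in>K. (*\<^sub>R) T ` lattice_cube (L / T) k)" by blast
  also have "\<dots> = (\<Union>k\<in>K. lattice_cube L k)" using T by (simp add: scale_lattice_cube)
  finally have "cost ((*\<^sub>R) T ` G) \<le> cost (\<Union>k\<in>K. lattice_cube L k)"
    using K by (intro cost_mono) (auto simp: bounded_lattice_cube)
  also have "\<dots> \<le> (\<Sum>k\<in>K. cost (lattice_cube L k))" by (intro cost_UNION K bounded_lattice_cube)
  also have "\<dots> = real (card K) * cube_cost L" by (simp add: cost_lattice_cube)
  finally have "cost ((*\<^sub>R) T ` G) / T ^ CARD('n) \<le> real (card K) * cube_cost L / T ^ CARD('n)"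
    using T by (intro divide_right_mono) auto
  also have "\<dots> = external_volume (L / T) G * (cube_cost L / L ^ CARD('n))"
    using L T by (simp add: external_volume_eq[OF \<delta>] K_def power_divide)
  finally show ?thesis .
qed

text \<open>Subadditivity alone only bounds costs from above.  A lower bound for \<open>T G\<close> comes from its complement
  in a cube of side \<open>2 m L\<close>: that cube costs at least \<open>cube_rate\<close> per volume, and the complement of \<open>T G\<close> in
  it is covered by the cubes of side \<open>L\<close> not contained in \<open>T G\<close>.\<close>

lemma cost_scaled_lower:
  assumes G: "bounded G" "\<And>t i. t \<in> G \<Longrightarrow> \<bar>t $ i\<bar> < R" and R: "0 < R" and L: "0 < L" and T: "0 < T"
  shows "(2 * (R + L / T)) ^ CARD('n) * (cube_rate - cube_cost L / L ^ CARD('n)) + internal_volume (L / T) G * (cube_cost L / L ^ CARD('n))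
    \<le> cost ((*\<^sub>R) T ` G) / T ^ CARD('n)"
proof -
  define d where "d = CARD('n)"
  define J where "J = {k. lattice_cube (L / T) k \<subseteq> G}"
  define m where "m = nat \<lceil>T * R / L\<rceil>"
  have \<delta>: "0 < L / T" using L T by simp
  have "0 < T * R / L" using T R L by simp
  then have m: "T * R / L \<le> real m" "real m \<le> T * R / L + 1" unfolding m_def by linarith+
  have m0: "0 < real m" using m(1) \<open>0 < T * R / L\<close> by linarith
  have TR: "T * R \<le> real m * L" using m(1) L by (simp add: field_simps)
  let ?I = "index_box m :: (int ^ 'n) set"
  have "J \<subseteq> ?I"
  proof
    fix k assume k: "k \<in> J"
    obtain t where t: "t \<in> lattice_cube (L / T) k"
    proof
      have "L / T * of_int (k $ i) < L / T * (of_int (k $ i) + 1)" for i using \<delta> by (intro mult_strict_left_mono) auto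
      then show "(\<chi> i. L / T * of_int (k $ i)) \<in> lattice_cube (L / T) k" unfolding lattice_cube_def by simp
    qed
    then have tR: "\<bar>t $ i\<bar> < R" for i using k G(2) by (auto simp: J_def)
    have "R \<le> real m * (L / T)" using TR T by (simp add: field_simps)
    then have "- (real m * (L / T)) \<le> t $ i \<and> t $ i < real m * (L / T)" for i using tR[of i] by linarith
    then show "k \<in> ?I" using mem_lattice_cube_index_box[OF \<delta> t] by blast
  qed
  note J_sub = this
  have J: "finite J" using finite_subset[OF J_sub card_index_box(1)] .
  have J_le: "card J \<le> card ?I" using card_mono[OF card_index_box(1) J_sub] .
  have J_diff: "card (?I - J) = card ?I - card J" using card_Diff_subset[OF J J_sub] .
  have inner: "(\<Union>k\<in>J. lattice_cube L k) \<subseteq> (*\<^sub>R) T ` G"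
  proof -
    have "lattice_cube L k \<subseteq> (*\<^sub>R) T ` G" if "k \<in> J" for k
    proof -
      have "lattice_cube L k = (*\<^sub>R) T ` lattice_cube (L / T) k" using T by (simp add: scale_lattice_cube)
      then show ?thesis using that by (auto simp: J_def)
    qed
    then show ?thesis by blast
  qed
  have bG: "bounded ((*\<^sub>R) T ` G)" using G(1) by (rule bounded_scaling)
  have rest: "bounded (\<Union>k\<in>?I - J. lattice_cube L k)"
    using card_index_box(1) by (intro bounded_UN) (auto simp: bounded_lattice_cube)
  have "cube_rate * (2 * (real m * L)) ^ d \<le> cube_cost (2 * (real m * L))"
    using cube_rate_le[of "2 * (real m * L)"] m0 L by (simp add: field_simps d_def)
  also have "\<dots> = cost (\<Union>k\<in>?I. lattice_cube L k)"
    unfolding UN_index_box[OF L] big_cube_translate cube_cost_def by (simp add: cost_translate)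
  also have "\<dots> \<le> cost ((*\<^sub>R) T ` G \<union> (\<Union>k\<in>?I - J. lattice_cube L k))"
  proof (rule cost_mono)
    show "(\<Union>k\<in>?I. lattice_cube L k) \<subseteq> (*\<^sub>R) T ` G \<union> (\<Union>k\<in>?I - J. lattice_cube L k)"
      using inner by blast
    show "bounded ((*\<^sub>R) T ` G \<union> (\<Union>k\<in>?I - J. lattice_cube L k))" using bG rest by simp
  qed
  also have "\<dots> \<le> cost ((*\<^sub>R) T ` G) + cost (\<Union>k\<in>?I - J. lattice_cube L k)"
    using bG rest by (rule cost_union)
  also have "cost (\<Union>k\<in>?I - J. lattice_cube L k) \<le> (\<Sum>k\<in>?I - J. cost (lattice_cube L k))"
    using card_index_box(1) by (intro cost_UNION bounded_lattice_cube) auto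
  also have "\<dots> = ((2 * real m) ^ d - real (card J)) * cube_cost L"
    using J_le J_diff card_index_box(2)[of m, where 'n='n] by (simp add: cost_lattice_cube of_nat_diff d_def)
  finally have main: "(2 * real m) ^ d * (L ^ d * cube_rate - cube_cost L) + real (card J) * cube_cost L \<le> cost ((*\<^sub>R) T ` G)"
    by (simp add: power_mult_distrib algebra_simps)
  \<comment> \<open>The coefficient of \<open>(2 m) ^ d\<close> is nonpositive, so \<open>m\<close> may be replaced by its upper bound \<open>T R / L + 1\<close>.\<close>
  have neg: "L ^ d * cube_rate - cube_cost L \<le> 0" using cube_rate_le[OF L] L by (simp add: field_simps d_def)
  have "2 * (R + L / T) * T / L = 2 * (T * R / L + 1)" using T L by (simp add: field_simps)
  then have "2 * real m \<le> 2 * (R + L / T) * T / L" using m(2) by simp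
  then have "(2 * real m) ^ d \<le> (2 * (R + L / T) * T / L) ^ d" by (intro power_mono) auto
  then have "(2 * (R + L / T) * T / L) ^ d * (L ^ d * cube_rate - cube_cost L) \<le> (2 * real m) ^ d * (L ^ d * cube_rate - cube_cost L)"
    using neg by (rule mult_right_mono_neg)
  then have "(2 * (R + L / T) * T / L) ^ d * (L ^ d * cube_rate - cube_cost L) + real (card J) * cube_cost L \<le> cost ((*\<^sub>R) T ` G)"
    using main by linarith
  then have "((2 * (R + L / T) * T / L) ^ d * (L ^ d * cube_rate - cube_cost L) + real (card J) * cube_cost L) / T ^ d \<le> cost ((*\<^sub>R) T ` G) / T ^ d"
    using T by (intro divide_right_mono) auto
  moreover have "((2 * (R + L / T) * T / L) ^ d * (L ^ d * cube_rate - cube_cost L) + real (card J) * cube_cost L) / T ^ d =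
    (2 * (R + L / T)) ^ d * (cube_rate - cube_cost L / L ^ d) + internal_volume (L / T) G * (cube_cost L / L ^ d)"
  proof -
    define x where "x = (2 * (R + L / T)) ^ d"
    have "(2 * (R + L / T) * T / L) ^ d = x * T ^ d / L ^ d" by (simp add: x_def power_mult_distrib power_divide)
    moreover have "internal_volume (L / T) G = real (card J) * (L ^ d / T ^ d)"
      by (simp add: internal_volume_eq[OF \<delta>] J_def d_def power_divide)
    ultimately show ?thesis using L T unfolding x_def[symmetric] by (simp add: field_simps)
  qed
  ultimately show ?thesis by (simp add: d_def)
qed

text \<open>As \<open>T \<rightarrow> \<infinity>\<close> with \<open>L\<close> fixed, the upper bound tends to \<open>|G| u\<close> and the lower one to
  \<open>(2 R)\<^sup>d (cube_rate - u) + |G| u\<close>, where \<open>u\<close> is the cost per volume of a cube of side \<open>L\<close>; a choice of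
  \<open>L\<close> with \<open>u\<close> close to \<open>cube_rate\<close> brings both near \<open>|G| cube_rate\<close>.\<close>

theorem cost_scaled_tendsto:
  assumes G: "bounded G" "0 < measure lebesgue G" "regular_boundary G"
  shows "((\<lambda>T. cost ((*\<^sub>R) T ` G) / T ^ CARD('n)) \<longlongrightarrow> measure lebesgue G * cube_rate) at_top"
proof -
  define V where "V = measure lebesgue G"
  have V: "0 < V" using G(2) by (simp add: V_def)
  have int0: "((\<lambda>\<delta>. internal_volume \<delta> G) \<longlongrightarrow> V) (at_right 0)" and ext0: "((\<lambda>\<delta>. external_volume \<delta> G) \<longlongrightarrow> V) (at_right 0)"
    using G(3) unfolding regular_boundary_def V_def by (auto intro: asymp_equivD_const)
  have LT0: "((\<lambda>T. L / T) \<longlongrightarrow> 0) at_top" for L :: real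
    by (intro tendsto_divide_0[OF tendsto_const] filterlim_at_top_imp_at_infinity filterlim_ident)
  have LT: "filterlim (\<lambda>T. L / T) (at_right 0) at_top" if "0 < L" for L :: real
    unfolding filterlim_at
  proof (intro conjI LT0)
    show "\<forall>\<^sub>F T in at_top. L / T \<in> {0<..} \<and> L / T \<noteq> 0"
      using eventually_gt_at_top[of 0] by eventually_elim (use that in auto)
  qed
  have int: "((\<lambda>T. internal_volume (L / T) G) \<longlongrightarrow> V) at_top" and ext: "((\<lambda>T. external_volume (L / T) G) \<longlongrightarrow> V) at_top"
    if "0 < L" for L
    using filterlim_compose[OF int0 LT[OF that]] filterlim_compose[OF ext0 LT[OF that]] by auto
  show ?thesis
    unfolding V_def[symmetric]
  proof (rule order_tendstoI)
    fix a assume a: "V * cube_rate < a"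
    define e where "e = (a - V * cube_rate) / V"
    have "0 < e" using a V by (simp add: e_def)
    then obtain L where L: "0 < L" and "cube_cost L / L ^ CARD('n) < cube_rate + e" by (rule cube_rate_approx)
    then have "V * (cube_cost L / L ^ CARD('n)) < V * (cube_rate + e)" using V by (intro mult_strict_left_mono)
    also have "\<dots> = a" using V by (simp add: e_def field_simps)
    finally have "V * (cube_cost L / L ^ CARD('n)) < a" .
    then have "\<forall>\<^sub>F T in at_top. external_volume (L / T) G * (cube_cost L / L ^ CARD('n)) < a"
      by (intro order_tendstoD(2)[OF tendsto_mult[OF ext[OF L] tendsto_const]])
    then show "\<forall>\<^sub>F T in at_top. cost ((*\<^sub>R) T ` G) / T ^ CARD('n) < a"
      using eventually_gt_at_top[of 0]
      by eventually_elim (use cost_scaled_upper[OF G(1) L] le_less_trans in blast)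
  next
    fix a assume a: "a < V * cube_rate"
    obtain R where R: "0 < R" "\<And>t. t \<in> G \<Longrightarrow> norm t < R" using G(1) by (auto simp: bounded_pos_less)
    then have Ri: "\<bar>t $ i\<bar> < R" if "t \<in> G" for t i using component_le_norm_cart[of t i] that by fastforce
    define e where "e = (V * cube_rate - a) / (2 * R) ^ CARD('n)"
    have R': "0 < (2 * R) ^ CARD('n)" using R by simp
    have "0 < e" using a R' by (simp add: e_def)
    then obtain L where L: "0 < L" and cL: "cube_cost L / L ^ CARD('n) < cube_rate + e" by (rule cube_rate_approx)
    define u where "u = cube_cost L / L ^ CARD('n)"
    have "a = - ((2 * R) ^ CARD('n) * e) + V * cube_rate" using R(1) by (simp add: e_def)
    also have "\<dots> \<le> - ((2 * R) ^ CARD('n) * e) + V * u"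
      using V cube_rate_le[OF L] unfolding u_def by (intro add_left_mono mult_left_mono) auto
    also have "(2 * R) ^ CARD('n) * (- e) < (2 * R) ^ CARD('n) * (cube_rate - u)"
      using R' cL by (intro mult_strict_left_mono) (auto simp: u_def)
    then have "- ((2 * R) ^ CARD('n) * e) + V * u < (2 * R) ^ CARD('n) * (cube_rate - u) + V * u" by simp
    also have "(2 * R) ^ CARD('n) * (cube_rate - u) + V * u = (2 * (R + 0)) ^ CARD('n) * (cube_rate - u) + V * u" by simp
    finally have "\<forall>\<^sub>F T in at_top. a < (2 * (R + L / T)) ^ CARD('n) * (cube_rate - u) + internal_volume (L / T) G * u"
      by (intro order_tendstoD(1)[OF tendsto_add[OF tendsto_mult[OF tendsto_power[OF tendsto_mult[OF tendsto_const tendsto_add[OF tendsto_const LT0]]] tendsto_const]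
        tendsto_mult[OF int[OF L] tendsto_const]]])
    then show "\<forall>\<^sub>F T in at_top. a < cost ((*\<^sub>R) T ` G) / T ^ CARD('n)"
      using eventually_gt_at_top[of 0]
      by eventually_elim (use cost_scaled_lower[OF G(1) Ri R(1) L] less_le_trans in \<open>unfold u_def, blast\<close>)
  qed
qed

lemma has_persistence_exponent:
  assumes G: "bounded G" "0 < measure lebesgue G" "regular_boundary G"
  shows "has_persistence_exponent M Y G (ereal (measure lebesgue G * cube_rate))"
  unfolding has_persistence_exponent_def
proof (rule Lim_transform_eventually)
  show "((\<lambda>T. ereal (cost ((*\<^sub>R) T ` G) / T ^ CARD('n))) \<longlongrightarrow> ereal (measure lebesgue G * cube_rate)) at_top"
    using cost_scaled_tendsto[OF G] by simp
  have "0 < pers ((*\<^sub>R) T ` G)" for T using G(1) by (intro pers_bounded_pos bounded_scaling)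
  then have neg: "neg_ln (pers ((*\<^sub>R) T ` G)) = ereal (cost ((*\<^sub>R) T ` G))" for T by (simp add: neg_ln_def cost_def not_le)
  show "\<forall>\<^sub>F T in at_top. ereal (cost ((*\<^sub>R) T ` G) / T ^ CARD('n)) = neg_ln (pers ((*\<^sub>R) T ` G)) / ereal (T ^ CARD('n))"
    using eventually_gt_at_top[of 0] by eventually_elim (simp add: neg)
qed

lemma cube_rate_pos:
  assumes "integrable lborel B"
  shows "0 < cube_rate"
proof -
  obtain c where c: "0 < c" "\<And>S. S \<in> sets lborel \<Longrightarrow> emeasure lborel S < \<infinity> \<Longrightarrow> pers S \<le> exp (- c * measure lborel S)"
    using pers_exponential_bound[OF assms] by blast
  have "c \<le> cube_cost L / L ^ CARD('n)" if L: "0 < L" for L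
  proof -
    have "pers (lattice_cube L 0) \<le> exp (- c * L ^ CARD('n))"
      using c(2)[OF _ emeasure_lattice_cube_finite, of L 0] lattice_cube_borel[of L 0]
      by (simp add: measure_lattice_cube[OF L])
    then have "ln (pers (lattice_cube L 0)) \<le> - c * L ^ CARD('n)"
      using pers_bounded_pos[OF bounded_lattice_cube[of L 0]] by (metis exp_gt_zero ln_exp ln_le_cancel_iff)
    then show ?thesis using L by (simp add: cube_cost_def cost_def field_simps)
  qed
  then have "c \<le> cube_rate" unfolding cube_rate_def by (intro cINF_greatest) auto
  then show ?thesis using c(1) by linarith
qed

end

lemma measure_region_pos:
  assumes "region G"
  shows "0 < measure lebesgue G"
proof -
  have "\<not> negligible (interior G)" using assms by (intro open_not_negligible) (auto simp: region_def)
  then have "\<not> negligible G" using interior_subset negligible_subset by blast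
  moreover have "G \<in> lmeasurable" using assms by (simp add: region_def)
  ultimately have "measure lebesgue G \<noteq> 0" by (simp add: negligible_iff_measure0)
  then show ?thesis using measure_nonneg[of lebesgue G] by linarith
qed

theorem theorem1:
  fixes M :: "'w measure"
    and Y :: "real ^ 'n \<Rightarrow> 'w \<Rightarrow> real"
    and B :: "real ^ 'n \<Rightarrow> real"
    and G :: "(real ^ 'n) set"
  assumes "gaussian_field M Y"
    and "centered_field M Y"
    and "continuous_paths M Y"
    and "homogeneous_cov M Y B"
    and "\<And>t. B t \<ge> 0"
    and "B 0 = 1"
    and "region G"
    and "bounded G"
    and "regular_boundary G"
  shows "\<exists>\<theta>::real. has_persistence_exponent M Y G (ereal \<theta>) \<and>
           (integrable lborel B \<longrightarrow> \<theta> > 0)"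
proof -
  interpret nonneg_gaussian_field M Y B using assms(1-6) by unfold_locales
  have V: "0 < measure lebesgue G" using measure_region_pos[OF assms(7)] .
  have "has_persistence_exponent M Y G (ereal (measure lebesgue G * cube_rate))"
    using assms(8) V assms(9) by (rule has_persistence_exponent)
  moreover have "0 < measure lebesgue G * cube_rate" if "integrable lborel B"
    using V cube_rate_pos[OF that] by simp
  ultimately show ?thesis by blast
qed

end
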